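(* Let $n\ge2$. The Lie algebras (inside $\mathrm{C}$, with bracket $[U,V]=UV-VU$) of the Lie groups $\mathrm{P},\mathrm{A},\mathrm{B},\mathrm{Q},\mathrm{Q}'$ are as follows. <ul> <li>$\mathfrak p=\mathrm{C}^{(0)}\oplus\mathrm{C}^n$ if $n$ is odd, and $\mathfrak p=\mathrm{C}^{(0)}$ if $n$ is even.</li> <li>$\mathfrak a=\mathrm{C}^0\oplus\mathrm{C}^{\overline2}\oplus\mathrm{C}^{\overline3}\oplus\mathrm{C}^n$ if $n\equiv1\pmod4$, and $\mathfrak a=\mathrm{C}^0\oplus\mathrm{C}^{\overline2}\oplus\mathrm{C}^{\overline3}$ otherwise.</li> <li>$\mathfrak b=\mathrm{C}^0\oplus\mathrm{C}^{\overline1}\oplus\mathrm{C}^{\overline2}\oplus\mathrm{C}^n$ if $n\equiv3\pmod4$, and $\mathfrak b=\mathrm{C}^0\oplus\mathrm{C}^{\overline1}\oplus\mathrm{C}^{\overline2}$ otherwise.</li> <li>$\mathfrak q=\mathrm{C}^0\oplus\mathrm{C}^{\overline2}\oplus\mathrm{C}^n$ if $n$ is odd, and $\mathfrak q=\mathrm{C}^0\oplus\mathrm{C}^{\overline2}$ if $n$ is even.</li> <li>$\mathfrak q'=\mathrm{C}^0\oplus\mathrm{C}^{\overline2}\oplus\mathrm{C}^n$ if $n\equiv0\pmod4$, and $\mathfrak q'=\mathfrak q$ otherwise.</li> </ul> Their dimensions are $\dim\mathfrak p=2^{n-1}+[n \text{ odd}]$, $\dim\mathfrak a=2^{n-1}-2^{\frac{n-1}{2}}\sin\frac{\pi(n+1)}4+1+[n\equiv1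 \bmod 4]$, $\dim\mathfrak b=2^{n-1}-2^{\frac{n-1}{2}}\cos\frac{\pi(n+1)}4+1+[n\equiv3\bmod 4]$, and $\dim\mathfrak q=2^{n-2}-2^{\frac{n-2}{2}}\cos\frac{\pi n}4+1+[n\text{ odd}]$; for $n\equiv0\pmod4$, $\dim\mathfrak q'=\dim\mathfrak q+1$. Here $[\cdot]$ is $1$ if the condition holds and $0$ otherwise. Moreover: <ul> <li>$\gamma\subseteq\mathfrak q\subseteq\mathfrak p$, $\mathfrak q\subseteq\mathfrak a$, $\mathfrak q\subseteq\mathfrak b$, and $\mathfrak q=\mathfrak a\cap\mathfrak p=\mathfrak b\cap\mathfrak p=\mathfrak a\cap\mathfrak b$.</li> <li>$\mathfrak q=\mathfrak p=\mathfrak a$ for $n\le3$.</li> <li>For $n=4$, the three algebras $\mathfrak q,\mathfrak p,\mathfrak a$ are pairwise distinct.</li> <li>$\gamma=\mathfrak q$ for $n\le5$, and $\gamma\ne\mathfrak q$ for $n=6$.</li> <li>For $n\equiv0\pmod4$: $\mathfrak q\subseteq\mathfrak q'\subseteq\mathfrak p$, $\gamma\subseteq\mathfrak q'$, and $\mathfrak q\ne\mathfrak q'$; furthermore $\mathfrak q'=\mathfrak p$ for $n=4$, and $\mathfrak q'\ne\mathfrak p$ for $n\ge8$.</li> </ul>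
   Context: Let $\mathrm{C}$ be either the real Clifford algebra $C\ell_{p,q}$ with $p+q=n$, or the complex Clifford algebra $C\ell(\mathbb{C}^n)$. It has identity $e$ and generators $e_1,\dots,e_n$ satisfying $e_ae_b+e_be_a=2\eta_{ab}e$. In the real case $\eta=\mathrm{diag}(1,\dots,1,-1,\dots,-1)$ with $p$ entries $+1$ and $q$ entries $-1$. In the complex case $\eta=I_n$. $\mathrm{C}^k$ is the grade-$k$ subspace, spanned by the products $e_{a_1}\cdots e_{a_k}$ with $a_1<\dots<a_k$. The even subspace is $\mathrm{C}^{(0)}=\bigoplus_{k\text{ even}}\mathrm{C}^k$ and the odd subspace is $\mathrm{C}^{(1)}=\bigoplus_{k\text{ odd}}\mathrm{C}^k$. For $m=0,1,2,3$ let $\mathrm{C}^{\overline m}=\bigoplus_{k\equiv m\pmod4}\mathrm{C}^k$. The grade involution $U\mapsto\hat U$ is the linear automorphism acting on $\mathrm{C}^k$ as $(-1)^k$. The reversion $U\mapsto\tilde U$ is the linear anti-automorphism acting on $\mathrm{C}^k$ as $(-1)^{k(k-1)/2}$. For $S\subseteq\mathrm{C}$, $S^\times$ is the set of elements of $S$ invertible in $\mathrm{C}$, and $\mathrm{C}^{\times(j)}:=(\mathrm{C}^{(j)})^\times$. $\mathrm{Z}$ is the center: $\mathrm{Z}=\mathrm{C}^0$ for $n$ even and $\mathrm{Z}=\mathrm{C}^0\oplus\mathrm{C}^n$ for $n$ odd. Define the following closed subgroups of $\mathrm{C}^\times$: <ul> <li>$\mathrm{P}:=\mathrm{Z}^\times(\mathrm{C}^{\times(0)}\cup\mathrm{C}^{\times(1)})=\{WT: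 W\in\mathrm{Z}^\times, T\in\mathrm{C}^{\times(0)}\cup\mathrm{C}^{\times(1)}\}$;</li> <li>$\mathrm{A}:=\{T\in\mathrm{C}^\times:\tilde TT\in\mathrm{Z}^\times\}$;</li> <li>$\mathrm{B}:=\{T\in\mathrm{C}^\times:\hat{\tilde T}T\in\mathrm{Z}^\times\}$;</li> <li>$\mathrm{Q}:=\{T\in\mathrm{P}:\tilde TT\in\mathrm{Z}^\times\}$;</li> <li>$\mathrm{Q}':=\{T\in\mathrm{P}:\tilde TT\in(\mathrm{C}^0\oplus\mathrm{C}^n)^\times\}$;</li> <li>the Clifford group $\Gamma=\{T\in\mathrm{C}^\times: T\,\mathrm{C}^1\,T^{-1}\subseteq\mathrm{C}^1\}$.</li> </ul> The Lie algebra of a closed subgroup $G\subseteq\mathrm{C}^\times$ is $\{U\in\mathrm{C}: \exp(tU)\in G\ \text{for all}\ t\in\mathbb{R}\}$. The Lie algebras of $\mathrm{P},\mathrm{A},\mathrm{B},\mathrm{Q},\mathrm{Q}'$ are denoted $\mathfrak p,\mathfrak a,\mathfrak b,\mathfrak q,\mathfrak q'$. The Lie algebra of $\Gamma$ is $\gamma$, which equals $\mathrm{C}^0\oplus\mathrm{C}^2$ for $n$ even and $\mathrm{C}^0\oplus\mathrm{C}^2\oplus\mathrm{C}^n$ for $n$ odd. Dimensions are over the ground field ($\mathbb{R}$ or $\mathbb{C}$). *)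

theory Defs
  imports "HOL-Analysis.Analysis" "HOL-Library.Function_Algebras"
begin

text \<open>
Clifford algebra with generators e_0,...,e_(n-1) (indices shifted by one w.r.t. the paper)
over a field 'k (instantiated with real or complex), with e_a e_b + e_b e_a = 2 eta_ab e,
eta diagonal with diagonal entries eta a.  An element is a coefficient function on the
basis blades e_A (A a finite subset of {0..<n}); the carrier is the set of such functions
supported in Pow {0..<n}.
\<close>

definition Cl :: "nat \<Rightarrow> (nat set \<Rightarrow> 'k::zero) set" where
  "Cl n = {U. \<forall>A. U A \<noteq> 0 \<longrightarrow> A \<subseteq> {0..<n}}"

text \<open>e_A e_B = (-1)^(#{(a,b) in A x B. b < a}) (prod_(a in A cap B) eta a) e_(A symdiff B)\<close>
definition blade_coeff :: "(nat \<Rightarrow> 'k::comm_ring_1) \<Rightarrow> nat set \<Rightarrow> nat set \<Rightarrow> 'k" where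
  "blade_coeff eta A B =
     (-1) ^ card {(a, b). a \<in> A \<and> b \<in> B \<and> b < a} * (\<Prod>a\<in>A \<inter> B. eta a)"

definition cmul :: "nat \<Rightarrow> (nat \<Rightarrow> 'k::comm_ring_1) \<Rightarrow> (nat set \<Rightarrow> 'k) \<Rightarrow> (nat set \<Rightarrow> 'k) \<Rightarrow> (nat set \<Rightarrow> 'k)" where
  "cmul n eta U V = (\<lambda>C. \<Sum>A\<in>Pow {0..<n}. \<Sum>B\<in>Pow {0..<n}.
      (if (A - B) \<union> (B - A) = C then blade_coeff eta A B * U A * V B else 0))"

definition cone :: "nat set \<Rightarrow> 'k::{zero,one}" where
  "cone = (\<lambda>A. if A = {} then 1 else 0)"

definition cscale :: "'k::times \<Rightarrow> (nat set \<Rightarrow> 'k) \<Rightarrow> (nat set \<Rightarrow> 'k)" where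
  "cscale c U = (\<lambda>A. c * U A)"

definition ghat :: "(nat set \<Rightarrow> 'k::comm_ring_1) \<Rightarrow> (nat set \<Rightarrow> 'k)" where
  "ghat U = (\<lambda>A. (-1) ^ card A * U A)"

definition crev :: "(nat set \<Rightarrow> 'k::comm_ring_1) \<Rightarrow> (nat set \<Rightarrow> 'k)" where
  "crev U = (\<lambda>A. (-1) ^ (card A * (card A - 1) div 2) * U A)"

definition gsp :: "nat \<Rightarrow> nat set \<Rightarrow> (nat set \<Rightarrow> 'k::zero) set" where
  "gsp n G = {U \<in> Cl n. \<forall>A. U A \<noteq> 0 \<longrightarrow> card A \<in> G}"

definition Cgr :: "nat \<Rightarrow> nat \<Rightarrow> (nat set \<Rightarrow> 'k::zero) set" where
  "Cgr n k = gsp n {k}"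

definition Ceven :: "nat \<Rightarrow> (nat set \<Rightarrow> 'k::zero) set" where
  "Ceven n = gsp n {k. even k}"

definition Codd :: "nat \<Rightarrow> (nat set \<Rightarrow> 'k::zero) set" where
  "Codd n = gsp n {k. odd k}"

definition Cbar :: "nat \<Rightarrow> nat \<Rightarrow> (nat set \<Rightarrow> 'k::zero) set" where
  "Cbar n m = gsp n {k. k mod 4 = m}"

definition dsum :: "(nat set \<Rightarrow> 'k::plus) set \<Rightarrow> (nat set \<Rightarrow> 'k) set \<Rightarrow> (nat set \<Rightarrow> 'k) set"
  (infixl "\<oplus>\<^sub>C" 65) where
  "X \<oplus>\<^sub>C Y = {(\<lambda>A. U A + V A) | U V. U \<in> X \<and> V \<in> Y}"

definition Zc :: "nat \<Rightarrow> (nat set \<Rightarrow> 'k::comm_monoid_add) set" where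
  "Zc n = (if even n then Cgr n 0 else Cgr n 0 \<oplus>\<^sub>C Cgr n n)"

definition units_in :: "nat \<Rightarrow> (nat \<Rightarrow> 'k::comm_ring_1) \<Rightarrow> (nat set \<Rightarrow> 'k) set \<Rightarrow> (nat set \<Rightarrow> 'k) set" where
  "units_in n eta S = {T \<in> S. T \<in> Cl n \<and>
      (\<exists>V\<in>Cl n. cmul n eta T V = cone \<and> cmul n eta V T = cone)}"

definition cinv :: "nat \<Rightarrow> (nat \<Rightarrow> 'k::comm_ring_1) \<Rightarrow> (nat set \<Rightarrow> 'k) \<Rightarrow> (nat set \<Rightarrow> 'k)" where
  "cinv n eta T = (THE V. V \<in> Cl n \<and> cmul n eta T V = cone \<and> cmul n eta V T = cone)"

definition Pgrp :: "nat \<Rightarrow> (nat \<Rightarrow> 'k::comm_ring_1) \<Rightarrow> (nat set \<Rightarrow> 'k) set" where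
  "Pgrp n eta = {cmul n eta W T | W T. W \<in> units_in n eta (Zc n) \<and>
      T \<in> units_in n eta (Ceven n) \<union> units_in n eta (Codd n)}"

definition Agrp :: "nat \<Rightarrow> (nat \<Rightarrow> 'k::comm_ring_1) \<Rightarrow> (nat set \<Rightarrow> 'k) set" where
  "Agrp n eta = {T \<in> units_in n eta (Cl n). cmul n eta (crev T) T \<in> units_in n eta (Zc n)}"

definition Bgrp :: "nat \<Rightarrow> (nat \<Rightarrow> 'k::comm_ring_1) \<Rightarrow> (nat set \<Rightarrow> 'k) set" where
  "Bgrp n eta = {T \<in> units_in n eta (Cl n). cmul n eta (ghat (crev T)) T \<in> units_in n eta (Zc n)}"

definition Qgrp :: "nat \<Rightarrow> (nat \<Rightarrow> 'k::comm_ring_1) \<Rightarrow> (nat set \<Rightarrow> 'k) set" where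
  "Qgrp n eta = {T \<in> Pgrp n eta. cmul n eta (crev T) T \<in> units_in n eta (Zc n)}"

definition Q'grp :: "nat \<Rightarrow> (nat \<Rightarrow> 'k::comm_ring_1) \<Rightarrow> (nat set \<Rightarrow> 'k) set" where
  "Q'grp n eta = {T \<in> Pgrp n eta.
      cmul n eta (crev T) T \<in> units_in n eta (Cgr n 0 \<oplus>\<^sub>C Cgr n n)}"

definition Gammagrp :: "nat \<Rightarrow> (nat \<Rightarrow> 'k::comm_ring_1) \<Rightarrow> (nat set \<Rightarrow> 'k) set" where
  "Gammagrp n eta = {T \<in> units_in n eta (Cl n).
      \<forall>X\<in>Cgr n 1. cmul n eta (cmul n eta T X) (cinv n eta T) \<in> Cgr n 1}"

text \<open>powers and exponential (series taken coefficientwise; the algebra is finite-dimensional)\<close>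
primrec cpow :: "nat \<Rightarrow> (nat \<Rightarrow> 'k::comm_ring_1) \<Rightarrow> (nat set \<Rightarrow> 'k) \<Rightarrow> nat \<Rightarrow> (nat set \<Rightarrow> 'k)" where
  "cpow n eta U 0 = cone"
| "cpow n eta U (Suc k) = cmul n eta U (cpow n eta U k)"

definition cexp :: "nat \<Rightarrow> (nat \<Rightarrow> 'k::real_normed_field) \<Rightarrow> (nat set \<Rightarrow> 'k) \<Rightarrow> (nat set \<Rightarrow> 'k)" where
  "cexp n eta U = (\<lambda>A. \<Sum>k. cpow n eta U k A / of_nat (fact k))"

definition lie :: "nat \<Rightarrow> (nat \<Rightarrow> 'k::real_normed_field) \<Rightarrow> (nat set \<Rightarrow> 'k) set \<Rightarrow> (nat set \<Rightarrow> 'k) set" where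
  "lie n eta G = {U \<in> Cl n. \<forall>t::real. cexp n eta (cscale (of_real t) U) \<in> G}"

definition cdim :: "(nat set \<Rightarrow> 'k::field) set \<Rightarrow> nat" where
  "cdim S = vector_space.dim cscale S"

definition ind :: "bool \<Rightarrow> real" where
  "ind b = (if b then 1 else 0)"

definition eta_pq :: "nat \<Rightarrow> nat \<Rightarrow> real" where
  "eta_pq p i = (if i < p then 1 else -1)"

definition lie_algebras_claims :: "nat \<Rightarrow> (nat \<Rightarrow> 'k::real_normed_field) \<Rightarrow> bool" where
  "lie_algebras_claims n eta \<longleftrightarrow>
   (let p = lie n eta (Pgrp n eta); a = lie n eta (Agrp n eta); b = lie n eta (Bgrp n eta);
        q = lie n eta (Qgrp n eta); q' = lie n eta (Q'grp n eta); g = lie n eta (Gammagrp n eta)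
    in
     \<comment> \<open>explicit descriptions\<close>
     p = (if odd n then Ceven n \<oplus>\<^sub>C Cgr n n else Ceven n) \<and>
     a = (if n mod 4 = 1 then Cgr n 0 \<oplus>\<^sub>C Cbar n 2 \<oplus>\<^sub>C Cbar n 3 \<oplus>\<^sub>C Cgr n n
          else Cgr n 0 \<oplus>\<^sub>C Cbar n 2 \<oplus>\<^sub>C Cbar n 3) \<and>
     b = (if n mod 4 = 3 then Cgr n 0 \<oplus>\<^sub>C Cbar n 1 \<oplus>\<^sub>C Cbar n 2 \<oplus>\<^sub>C Cgr n n
          else Cgr n 0 \<oplus>\<^sub>C Cbar n 1 \<oplus>\<^sub>C Cbar n 2) \<and>
     q = (if odd n then Cgr n 0 \<oplus>\<^sub>C Cbar n 2 \<oplus>\<^sub>C Cgr n n else Cgr n 0 \<oplus>\<^sub>C Cbar n 2) \<and>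
     q' = (if n mod 4 = 0 then Cgr n 0 \<oplus>\<^sub>C Cbar n 2 \<oplus>\<^sub>C Cgr n n else q) \<and>
     \<comment> \<open>dimensions\<close>
     real (cdim p) = 2 ^ (n - 1) + ind (odd n) \<and>
     real (cdim a) = 2 ^ (n - 1) - 2 powr ((real n - 1) / 2) * sin (pi * (real n + 1) / 4)
                     + 1 + ind (n mod 4 = 1) \<and>
     real (cdim b) = 2 ^ (n - 1) - 2 powr ((real n - 1) / 2) * cos (pi * (real n + 1) / 4)
                     + 1 + ind (n mod 4 = 3) \<and>
     real (cdim q) = 2 ^ (n - 2) - 2 powr ((real n - 2) / 2) * cos (pi * real n / 4)
                     + 1 + ind (odd n) \<and>
     (n mod 4 = 0 \<longrightarrow> cdim q' = cdim q + 1) \<and>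
     \<comment> \<open>inclusions and intersections\<close>
     g \<subseteq> q \<and> q \<subseteq> p \<and> q \<subseteq> a \<and> q \<subseteq> b \<and>
     q = a \<inter> p \<and> q = b \<inter> p \<and> q = a \<inter> b \<and>
     (n \<le> 3 \<longrightarrow> q = p \<and> p = a) \<and>
     (n = 4 \<longrightarrow> q \<noteq> p \<and> p \<noteq> a \<and> q \<noteq> a) \<and>
     (n \<le> 5 \<longrightarrow> g = q) \<and>
     (n = 6 \<longrightarrow> g \<noteq> q) \<and>
     (n mod 4 = 0 \<longrightarrow> q \<subseteq> q' \<and> q' \<subseteq> p \<and> g \<subseteq> q' \<and> q \<noteq> q' \<and>
        (n = 4 \<longrightarrow> q' = p) \<and> (n \<ge> 8 \<longrightarrow> q' \<noteq> p)))"

end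

theory Submission
  imports Defs
begin

text \<open>
Every group in question is cut out by a condition on a product of two exponentials
\<open>exp(tX) W exp(tY)\<close>: with the grade involution \<open>ghat\<close> and the reversion \<open>crev\<close>, both diagonal in
the blade basis, these are \<open>crev(T) T\<close> for \<open>A\<close>, \<open>ghat(crev(T)) T\<close> for \<open>B\<close>, \<open>T\<^sup>-\<^sup>1 ghat(T)\<close> for \<open>P\<close>
and \<open>T v T\<^sup>-\<^sup>1\<close> for the Clifford group, where \<open>T = exp(tU)\<close>. Differentiating at \<open>t = 0\<close> gives a
linear condition on \<open>U\<close>, for instance \<open>U + crev(U) \<in> Z\<close> for \<open>A\<close>. Conversely, such a condition forces
the two exponents to commute, so the product is the exponential of a central element. The linear
conditions only restrict the grades occurring in \<open>U\<close>; hence all six Lie algebras are sums of grade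
subspaces, all inclusions reduce to arithmetic modulo 4, and the dimensions are sums of binomial
coefficients over residue classes modulo 4.
\<close>

text \<open>The algebra is the group algebra of the subsets of \<open>{0..<n}\<close> under
  symmetric difference, twisted by \<open>blade_coeff\<close>, so associativity is a cocycle
  identity. Asking only that each \<open>eta i\<close> squares to 1 treats all real signatures and
  the complex case at once. The exponents \<open>X\<close> and \<open>U\<close> commute because a
  central sum \<open>X + U\<close> commutes with \<open>U\<close>. Three groups need something else.
  In Q' with \<open>n\<close> even, grade \<open>n\<close> is not central; but membership in P makes
  \<open>U\<close> even, and the pseudoscalar commutes with even elements. P is a product set and
  not the solution set of an equation: centrality of the inverse of T times \<open>ghat T\<close>
  serves only as a necessary condition, and for the converse \<open>U\<close> is split into its odd
  part, which is then central, and its even part, whose exponentials are the two factors. For the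
  Clifford group nothing has to commute: every Taylor coefficient of the conjugate of a vector is
  again a vector. The parameter \<open>t\<close> stays real over both fields, so derivatives at 0
  are recovered from real points alone.\<close>

locale clifford =
  fixes n :: nat and eta :: "nat \<Rightarrow> 'k::{real_normed_field,banach}"
  assumes eta_square: "eta i * eta i = 1"
begin

abbreviation I :: "nat set" where "I \<equiv> {0..<n}"

abbreviation bc :: "nat set \<Rightarrow> nat set \<Rightarrow> 'k" where "bc \<equiv> blade_coeff eta"

abbreviation mul :: "(nat set \<Rightarrow> 'k) \<Rightarrow> (nat set \<Rightarrow> 'k) \<Rightarrow> (nat set \<Rightarrow> 'k)" (infixl "\<star>" 70)
  where "U \<star> V \<equiv> cmul n eta U V"

subsection \<open>The algebra structure\<close>

text \<open>Extending both products to the fixed ranges \<open>I \<times> I\<close> and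
  \<open>I\<close>, with factor 1 where nothing happens, allows coefficients of different blades to
  be compared factor by factor.\<close>

lemma blade_coeff_prod:
  assumes "A \<subseteq> I" "B \<subseteq> I"
  shows "bc A B = (\<Prod>(a, b)\<in>I \<times> I. if a \<in> A \<and> b \<in> B \<and> b < a then -1 else 1) *
    (\<Prod>a\<in>I. if a \<in> A \<and> a \<in> B then eta a else 1)"
proof -
  let ?S = "{(a, b). a \<in> A \<and> b \<in> B \<and> b < a}"
  have S: "?S = {x \<in> I \<times> I. x \<in> ?S}" using assms by auto
  have "(-1 :: 'k) ^ card ?S = (\<Prod>x\<in>?S. -1)" by simp
  also have "\<dots> = (\<Prod>x\<in>I \<times> I. if x \<in> ?S then -1 else 1)"
    by (subst S, subst prod.inter_filter[symmetric]) auto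
  also have "\<dots> = (\<Prod>(a, b)\<in>I \<times> I. if a \<in> A \<and> b \<in> B \<and> b < a then -1 else 1)"
    by (intro prod.cong) (auto split: if_splits)
  finally have 1: "(-1 :: 'k) ^ card ?S = \<dots>" .
  have "A \<inter> B = {a \<in> I. a \<in> A \<and> a \<in> B}" using assms by auto
  then have "(\<Prod>a\<in>A \<inter> B. eta a) = (\<Prod>a\<in>I. if a \<in> A \<and> a \<in> B then eta a else 1)"
    by (simp only: prod.inter_filter finite_atLeastLessThan)
  with 1 show ?thesis by (simp add: blade_coeff_def)
qed

lemma mult_mult_mult_swap: "(a * b) * (c * d) = (a * c) * (b * d)" for a b c d :: 'k
  by (simp add: mult_ac)

text \<open>This is associativity on blades. Membership in a symmetric difference is additive modulo
  2, so at a pair \<open>b < a\<close> either side has the exponent [a in A][b in B] +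
  [a in A][b in C] + [a in B][b in C]. The factor \<open>eta a\<close> appears once on either side
  exactly when \<open>a\<close> lies in at least two of the three sets.\<close>

lemma blade_coeff_cocycle:
  assumes "A \<subseteq> I" "B \<subseteq> I" "C \<subseteq> I"
  shows "bc A B * bc (sym_diff A B) C = bc A (sym_diff B C) * bc B C"
proof -
  have 1: "sym_diff A B \<subseteq> I" "sym_diff B C \<subseteq> I" using assms by auto
  define s :: "nat set \<Rightarrow> nat set \<Rightarrow> 'k" where
    "s A B = (\<Prod>(a, b)\<in>I \<times> I. if a \<in> A \<and> b \<in> B \<and> b < a then -1 else 1)" for A B
  define h where "h A B = (\<Prod>a\<in>I. if a \<in> A \<and> a \<in> B then eta a else 1)" for A B
  have s: "s A B * s (sym_diff A B) C = s A (sym_diff B C) * s B C"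
    unfolding s_def prod.distrib[symmetric]
    by (rule prod.cong[OF refl], clarsimp simp only: split_paired_all prod.case Un_iff Diff_iff) (simp split: if_split)
  have h: "h A B * h (sym_diff A B) C = h A (sym_diff B C) * h B C"
    unfolding h_def prod.distrib[symmetric]
  proof (rule prod.cong[OF refl])
    fix a
    let ?t = "\<lambda>P. if P then eta a else 1"
    show "?t (a \<in> A \<and> a \<in> B) * ?t (a \<in> sym_diff A B \<and> a \<in> C)
      = ?t (a \<in> A \<and> a \<in> sym_diff B C) * ?t (a \<in> B \<and> a \<in> C)"
      by (cases "a \<in> A"; cases "a \<in> B"; cases "a \<in> C") simp_all
  qed
  have bc: "bc A B = s A B * h A B" if "A \<subseteq> I" "B \<subseteq> I" for A B
    unfolding s_def h_def using that by (rule blade_coeff_prod)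
  have "bc A B * bc (sym_diff A B) C = (s A B * s (sym_diff A B) C) * (h A B * h (sym_diff A B) C)"
    unfolding bc[OF assms(1,2)] bc[OF 1(1) assms(3)] by (rule mult_mult_mult_swap)
  also have "\<dots> = (s A (sym_diff B C) * s B C) * (h A (sym_diff B C) * h B C)"
    unfolding s h ..
  also have "\<dots> = bc A (sym_diff B C) * bc B C"
    unfolding bc[OF assms(2,3)] bc[OF assms(1) 1(2)] by (rule mult_mult_mult_swap)
  finally show ?thesis .
qed

text \<open>Every pair in \<open>A \<times> B\<close> is an inversion for one order of the factors,
  an inversion for the other, or diagonal. Hence the two inversion counts and
  \<open>card (A \<inter> B)\<close> add up to \<open>card A * card B\<close>.\<close>

lemma blade_coeff_swap:
  assumes "finite A" "finite B"
  shows "bc B A = (-1) ^ (card A * card B + card (A \<inter> B)) * bc A B"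
proof -
  let ?S = "{(a, b). a \<in> A \<and> b \<in> B \<and> b < a}" and ?T = "{(b, a). b \<in> B \<and> a \<in> A \<and> a < b}"
  let ?D = "(\<lambda>a. (a, a)) ` (A \<inter> B)" and ?T' = "{(a, b). a \<in> A \<and> b \<in> B \<and> a < b}"
  have fin: "finite ?S" "finite ?T'" "finite ?D"
    by (rule finite_subset[of _ "A \<times> B"]; use assms in auto)+
  have "A \<times> B = ?S \<union> (?T' \<union> ?D)" by auto
  then have "card A * card B = card (?S \<union> (?T' \<union> ?D))" using card_cartesian_product by metis
  also have "\<dots> = card ?S + (card ?T' + card ?D)"
    using fin by (subst card_Un_disjoint; (subst card_Un_disjoint)?) auto
  also have "card ?D = card (A \<inter> B)" by (intro card_image) (auto simp: inj_on_def)
  also have "card ?T' = card ?T"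
    by (rule bij_betw_same_card[of prod.swap]) (force simp: bij_betw_def inj_on_def)
  finally have "card A * card B + card (A \<inter> B) + card ?S = 2 * (card ?S + card (A \<inter> B)) + card ?T"
    by simp
  then have "(-1 :: 'k) ^ card ?T = (-1) ^ (card A * card B + card (A \<inter> B) + card ?S)"
    by (simp add: power_add)
  then show ?thesis by (simp add: blade_coeff_def power_add Int_commute)
qed

lemma norm_eta [simp]: "norm (eta i) = 1"
proof -
  have "norm (eta i) ^ 2 = 1 ^ 2"
    by (metis eta_square norm_mult norm_one one_power2 power2_eq_square)
  then show ?thesis by (subst (asm) power_eq_iff_eq_base) auto
qed

text \<open>Structure constants of norm 1 make the coefficient norm \<open>l1\<close>
  submultiplicative.\<close>

lemma norm_blade_coeff [simp]: "norm (bc A B) = 1"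
  by (simp add: blade_coeff_def norm_mult norm_power prod_norm[symmetric])

lemma blade_coeff_nonzero [simp]: "bc A B \<noteq> 0"
  by (metis norm_blade_coeff norm_zero zero_neq_one)

lemma cmul_altdef:
  "(U \<star> V) C = (\<Sum>A\<in>Pow I. \<Sum>B\<in>Pow I. bc A B * U A * V B * (if sym_diff A B = C then 1 else 0))"
  unfolding cmul_def by (intro sum.cong refl) simp

text \<open>The function \<open>F\<close> stands for whatever else a larger expression does with the
  product. In \<open>cmul_assoc\<close> this flattens either bracketing to a triple sum over
  blades.\<close>

lemma sum_cmul:
  "(\<Sum>X\<in>Pow I. (U \<star> V) X * F X) = (\<Sum>A\<in>Pow I. \<Sum>B\<in>Pow I. bc A B * U A * V B * F (sym_diff A B))"
proof -
  have "(\<Sum>X\<in>Pow I. (U \<star> V) X * F X) =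
    (\<Sum>X\<in>Pow I. \<Sum>A\<in>Pow I. \<Sum>B\<in>Pow I. bc A B * U A * V B * (if sym_diff A B = X then F X else 0))"
    unfolding cmul_altdef sum_distrib_right by (intro sum.cong refl) auto
  also have "\<dots> = (\<Sum>A\<in>Pow I. \<Sum>B\<in>Pow I. \<Sum>X\<in>Pow I. bc A B * U A * V B * (if sym_diff A B = X then F X else 0))"
    by (subst sum.swap, rule sum.cong[OF refl], rule sum.swap)
  also have "\<dots> = (\<Sum>A\<in>Pow I. \<Sum>B\<in>Pow I. bc A B * U A * V B * F (sym_diff A B))"
    unfolding sum_distrib_left[symmetric] by (intro sum.cong refl) (subst sum.delta', auto)
  finally show ?thesis .
qed

lemma cmul_assoc: "U \<star> V \<star> W = U \<star> (V \<star> W)"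
proof
  fix D :: "nat set"
  let ?d = "\<lambda>A B. if sym_diff A B = D then 1 else (0::'k)"
  have "(U \<star> V \<star> W) D = (\<Sum>X\<in>Pow I. (U \<star> V) X * (\<Sum>C\<in>Pow I. bc X C * W C * ?d X C))"
    unfolding cmul_altdef[of "U \<star> V"] sum_distrib_left by (intro sum.cong refl) (simp add: mult_ac)
  also have "\<dots> = (\<Sum>A\<in>Pow I. \<Sum>B\<in>Pow I. \<Sum>C\<in>Pow I.
      (bc A B * bc (sym_diff A B) C) * U A * V B * W C * ?d (sym_diff A B) C)"
    unfolding sum_cmul unfolding sum_distrib_left by (intro sum.cong refl) (simp add: mult_ac)
  also have "\<dots> = (\<Sum>A\<in>Pow I. \<Sum>B\<in>Pow I. \<Sum>C\<in>Pow I.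
      (bc A (sym_diff B C) * bc B C) * U A * V B * W C * ?d A (sym_diff B C))"
  proof (intro sum.cong refl)
    fix A B C assume "A \<in> Pow I" "B \<in> Pow I" "C \<in> Pow I"
    then have 1: "bc A B * bc (sym_diff A B) C = bc A (sym_diff B C) * bc B C"
      by (intro blade_coeff_cocycle) auto
    have 2: "sym_diff (sym_diff A B) C = sym_diff A (sym_diff B C)" by auto
    show "(bc A B * bc (sym_diff A B) C) * U A * V B * W C * ?d (sym_diff A B) C
      = (bc A (sym_diff B C) * bc B C) * U A * V B * W C * ?d A (sym_diff B C)"
      unfolding 1 2 ..
  qed
  also have "\<dots> = (\<Sum>A\<in>Pow I. \<Sum>Y\<in>Pow I. (V \<star> W) Y * (bc A Y * U A * ?d A Y))"
    unfolding sum_cmul by (intro sum.cong refl) (simp add: mult_ac)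
  also have "\<dots> = (U \<star> (V \<star> W)) D"
    unfolding cmul_altdef[of U] by (intro sum.cong refl) (simp add: mult_ac)
  finally show "(U \<star> V \<star> W) D = (U \<star> (V \<star> W)) D" .
qed

lemma cmul_in_Cl [simp, intro]: "U \<star> V \<in> Cl n"
proof -
  have "(U \<star> V) C = 0" if "\<not> C \<subseteq> I" for C
    unfolding cmul_altdef using that by (intro sum.neutral ballI) auto
  then show ?thesis by (auto simp: Cl_def)
qed

lemma cmul_add_left: "(U + V) \<star> W = U \<star> W + V \<star> W"
  by (rule ext) (simp add: cmul_altdef algebra_simps sum.distrib)

lemma cmul_add_right: "W \<star> (U + V) = W \<star> U + W \<star> V"
  by (rule ext) (simp add: cmul_altdef algebra_simps sum.distrib)

lemma cmul_scale_left: "cscale c U \<star> W = cscale c (U \<star> W)"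
  by (rule ext) (simp add: cmul_altdef cscale_def sum_distrib_left mult_ac)

lemma cmul_scale_right: "W \<star> cscale c U = cscale c (W \<star> U)"
  by (rule ext) (simp add: cmul_altdef cscale_def sum_distrib_left mult_ac)

lemma cmul_zero_left [simp]: "0 \<star> W = 0"
  by (rule ext) (simp add: cmul_altdef)

lemma cmul_zero_right [simp]: "W \<star> 0 = 0"
  by (rule ext) (simp add: cmul_altdef)

lemma uminus_eq_cscale: "- U = cscale (-1) U" for U :: "nat set \<Rightarrow> 'k"
  by (rule ext) (simp add: cscale_def)

lemma cmul_minus_left: "(- U) \<star> W = - (U \<star> W)"
  unfolding uminus_eq_cscale cmul_scale_left ..

lemma cmul_minus_right: "W \<star> (- U) = - (W \<star> U)"
  unfolding uminus_eq_cscale cmul_scale_right ..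

lemma cmul_sum_left: "(\<Sum>i\<in>J. f i) \<star> W = (\<Sum>i\<in>J. f i \<star> W)"
  by (induction J rule: infinite_finite_induct) (simp_all only: sum.infinite sum.empty sum.insert not_False_eq_True
      cmul_zero_left cmul_zero_right cmul_add_left)

lemma cmul_sum_right: "W \<star> (\<Sum>i\<in>J. f i) = (\<Sum>i\<in>J. W \<star> f i)"
  by (induction J rule: infinite_finite_induct) (simp_all only: sum.infinite sum.empty sum.insert not_False_eq_True
      cmul_zero_left cmul_zero_right cmul_add_right)

section \<open>Basis blades and multiplication by them\<close>

definition blade :: "nat set \<Rightarrow> nat set \<Rightarrow> 'k" where
  "blade B = (\<lambda>A. if A = B then 1 else 0)"

lemma sym_diff_eq_iff: "sym_diff A B = C \<longleftrightarrow> A = sym_diff C B"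
  by auto

text \<open>Multiplication by a blade permutes coordinates up to nonzero factors: only
  \<open>sym_diff C B\<close> feeds \<open>C\<close>, so no cancellation can occur.\<close>

lemma cmul_blade_right:
  assumes "B \<subseteq> I" "C \<subseteq> I"
  shows "(U \<star> blade B) C = bc (sym_diff C B) B * U (sym_diff C B)"
proof -
  have "(U \<star> blade B) C =
    (\<Sum>A\<in>Pow I. \<Sum>X\<in>Pow I. if X = B then bc A B * U A * (if sym_diff A B = C then 1 else 0) else 0)"
    unfolding cmul_altdef blade_def by (intro sum.cong refl) auto
  also have "\<dots> = (\<Sum>A\<in>Pow I. if A = sym_diff C B then bc A B * U A else 0)"
    using assms unfolding sym_diff_eq_iff by (intro sum.cong refl) (subst sum.delta, auto)
  also have "\<dots> = bc (sym_diff C B) B * U (sym_diff C B)"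
    using assms by (subst sum.delta) auto
  finally show ?thesis .
qed

lemma cmul_blade_left:
  assumes "B \<subseteq> I" "C \<subseteq> I"
  shows "(blade B \<star> U) C = bc B (sym_diff C B) * U (sym_diff C B)"
proof -
  have "(blade B \<star> U) C =
    (\<Sum>X\<in>Pow I. \<Sum>A\<in>Pow I. if X = B then bc B A * U A * (if sym_diff B A = C then 1 else 0) else 0)"
    unfolding cmul_altdef blade_def by (intro sum.cong refl) auto
  also have "\<dots> = (\<Sum>A\<in>Pow I. \<Sum>X\<in>Pow I. if X = B then bc B A * U A * (if sym_diff B A = C then 1 else 0) else 0)"
    by (rule sum.swap)
  also have "\<dots> = (\<Sum>A\<in>Pow I. if A = sym_diff C B then bc B A * U A else 0)"
    using assms unfolding sym_diff_eq_iff[symmetric]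
    by (intro sum.cong refl) (subst sum.delta, auto simp: Un_commute)
  also have "\<dots> = bc B (sym_diff C B) * U (sym_diff C B)"
    using assms by (subst sum.delta) auto
  finally show ?thesis .
qed

lemma cone_eq_blade: "cone = blade {}"
  by (rule ext) (simp add: cone_def blade_def)

lemma blade_in_Cl: "B \<subseteq> I \<Longrightarrow> blade B \<in> Cl n"
  by (auto simp: Cl_def blade_def)

lemma cone_in_Cl [simp]: "(cone :: nat set \<Rightarrow> 'k) \<in> Cl n"
  by (simp add: cone_eq_blade blade_in_Cl)

lemma Cl_eqI:
  assumes "U \<in> Cl n" "V \<in> Cl n" "\<And>A. A \<subseteq> I \<Longrightarrow> U A = V A"
  shows "U = V"
proof
  fix A
  have "U A = 0" "V A = 0" if "\<not> A \<subseteq> I" using assms(1,2) that unfolding Cl_def by blast+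
  then show "U A = V A" using assms(3) by metis
qed

lemma cmul_cone_right [simp]: "U \<in> Cl n \<Longrightarrow> U \<star> cone = U"
  unfolding cone_eq_blade by (rule Cl_eqI) (simp_all add: cmul_blade_right blade_coeff_def)

lemma cmul_cone_left [simp]: "U \<in> Cl n \<Longrightarrow> cone \<star> U = U"
  unfolding cone_eq_blade by (rule Cl_eqI) (simp_all add: cmul_blade_left blade_coeff_def)

lemma Cl_add [intro]: "U \<in> Cl n \<Longrightarrow> V \<in> Cl n \<Longrightarrow> U + V \<in> Cl n" for U V :: "nat set \<Rightarrow> 'k"
  unfolding Cl_def mem_Collect_eq plus_fun_apply by (metis add.right_neutral)

lemma Cl_cscale [intro, simp]: "U \<in> Cl n \<Longrightarrow> cscale c U \<in> Cl n" for U :: "nat set \<Rightarrow> 'k"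
  by (auto simp: Cl_def cscale_def)

lemma Cl_uminus [intro, simp]: "U \<in> Cl n \<Longrightarrow> - U \<in> Cl n" for U :: "nat set \<Rightarrow> 'k"
  by (simp add: uminus_eq_cscale)

lemma Cl_ghat [intro, simp]: "U \<in> Cl n \<Longrightarrow> ghat U \<in> Cl n" for U :: "nat set \<Rightarrow> 'k"
  by (auto simp: Cl_def ghat_def)

lemma Cl_crev [intro, simp]: "U \<in> Cl n \<Longrightarrow> crev U \<in> Cl n" for U :: "nat set \<Rightarrow> 'k"
  by (auto simp: Cl_def crev_def)

section \<open>The grade involution and the reversion on products\<close>

lemma card_sym_diff:
  assumes "finite A" "finite B"
  shows "card (sym_diff A B) + 2 * card (A \<inter> B) = card A + card B"
proof -
  have "card (sym_diff A B) = card (A - B) + card (B - A)"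
    using assms by (intro card_Un_disjoint) auto
  moreover have "card A = card (A - B) + card (A \<inter> B)"
    using assms by (metis add.commute card_Int_Diff)
  moreover have "card B = card (B - A) + card (A \<inter> B)"
    using assms by (metis add.commute card_Int_Diff inf_commute)
  ultimately show ?thesis by simp
qed

lemma ghat_cmul: "ghat (U \<star> V) = ghat U \<star> ghat V"
proof
  fix C
  have "(-1 :: 'k) ^ card (sym_diff A B) = (-1) ^ card A * (-1) ^ card B"
    if "A \<in> Pow I" "B \<in> Pow I" for A B
  proof -
    have "(-1 :: 'k) ^ (card (sym_diff A B) + 2 * card (A \<inter> B)) = (-1) ^ (card A + card B)"
      using that by (subst card_sym_diff) (auto intro: finite_subset)
    then show ?thesis by (simp add: power_add)
  qed
  then show "ghat (U \<star> V) C = (ghat U \<star> ghat V) C"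
    unfolding ghat_def cmul_altdef sum_distrib_left by (intro sum.cong refl) auto
qed

lemma neg_one_power_eq_iff: "(-1 :: 'k) ^ i = (-1) ^ j \<longleftrightarrow> (even i \<longleftrightarrow> even j)"
  by (auto simp: minus_one_power_iff)

text \<open>Put T(k) = k(k-1)/2. Then d = a+b-2c gives T(d) = T(a) + T(b) + ab + c + 2(c*c -
  c(a+b)). With \<open>d\<close> the size of a symmetric difference and \<open>c\<close> that of the
  intersection, ab + c is the exponent in \<open>blade_coeff_swap\<close>.\<close>

lemma reversion_sign_parity:
  fixes a b c d :: nat
  assumes "d + 2 * c = a + b"
  shows "even (d * (d - 1) div 2 + (a * (a - 1) div 2 + b * (b - 1) div 2 + a * b + c))"
proof -
  \<comment> \<open>Doubling and passing to the integers removes the division and the truncated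
    subtraction before anything is expanded.\<close>
  have tri: "int (2 * (k * (k - 1) div 2)) = int k * (int k - 1)" for k :: nat
  proof -
    have "even (k * (k - 1))" by (cases k) auto
    then have "2 * (k * (k - 1) div 2) = k * (k - 1)" by simp
    then show ?thesis by (cases k) (auto simp: algebra_simps)
  qed
  have d: "int d = int a + int b - 2 * int c" using assms by linarith
  have "int (2 * (d * (d - 1) div 2)) + int (2 * (a * (a - 1) div 2)) + int (2 * (b * (b - 1) div 2))
    + 2 * (int a * int b + int c)
    = 2 * (2 * (int (2 * (a * (a - 1) div 2)) div 2 + int (2 * (b * (b - 1) div 2)) div 2
      + int a * int b + int c - int c * (int a + int b) + int c * int c))"
    unfolding tri d using tri[of a] tri[of b] by (simp add: algebra_simps)
  then have "int (d * (d - 1) div 2 + (a * (a - 1) div 2 + b * (b - 1) div 2 + a * b + c))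
    = 2 * (int (2 * (a * (a - 1) div 2)) div 2 + int (2 * (b * (b - 1) div 2)) div 2
      + int a * int b + int c - int c * (int a + int b) + int c * int c)"
    by simp
  then show ?thesis by (metis dvd_triv_left even_of_nat)
qed

text \<open>The reversion sign of a product blade differs from the product of the two reversion
  signs by exactly the sign of swapping the factors, so the order is reversed.\<close>

lemma crev_cmul: "crev (U \<star> V) = crev V \<star> crev U"
proof
  fix C
  let ?r = "\<lambda>A. (-1 :: 'k) ^ (card A * (card A - 1) div 2)"
  have key: "?r (sym_diff A B) * bc A B = ?r A * ?r B * bc B A" if "A \<in> Pow I" "B \<in> Pow I" for A B
  proof -
    have fin: "finite A" "finite B" using that by (auto intro: finite_subset)
    have "even (card (sym_diff A B) * (card (sym_diff A B) - 1) div 2 +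
      (card A * (card A - 1) div 2 + card B * (card B - 1) div 2 + card A * card B + card (A \<inter> B)))"
      by (rule reversion_sign_parity) (rule card_sym_diff[OF fin])
    then have "?r (sym_diff A B) = (-1) ^ (card A * (card A - 1) div 2 + card B * (card B - 1) div 2
        + card A * card B + card (A \<inter> B))"
      unfolding neg_one_power_eq_iff by simp
    then show ?thesis
      unfolding blade_coeff_swap[OF fin] by (simp add: power_add)
  qed
  have "crev (U \<star> V) C = (\<Sum>A\<in>Pow I. \<Sum>B\<in>Pow I. (?r (sym_diff A B) * bc A B) * U A * V B
      * (if sym_diff A B = C then 1 else 0))"
    unfolding crev_def cmul_altdef sum_distrib_left by (intro sum.cong refl) auto
  also have "\<dots> = (\<Sum>A\<in>Pow I. \<Sum>B\<in>Pow I. (?r A * ?r B * bc B A) * U A * V B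
      * (if sym_diff A B = C then 1 else 0))"
    by (intro sum.cong refl) (simp only: key)
  also have "\<dots> = (crev V \<star> crev U) C"
    unfolding crev_def cmul_altdef
    by (subst sum.swap, intro sum.cong refl) (auto simp: Un_commute)
  finally show "crev (U \<star> V) C = (crev V \<star> crev U) C" .
qed


subsection \<open>Grade subspaces\<close>

lemma gsp_iff: "U \<in> gsp n G \<longleftrightarrow> U \<in> Cl n \<and> (\<forall>A. A \<subseteq> I \<longrightarrow> card A \<notin> G \<longrightarrow> U A = 0)"
  for U :: "nat set \<Rightarrow> 'k"
  unfolding gsp_def Cl_def by blast

lemma gsp_in_Cl: "U \<in> gsp n G \<Longrightarrow> U \<in> Cl n" for U :: "nat set \<Rightarrow> 'k"
  by (simp add: gsp_iff)

lemma gsp_cscale: "U \<in> gsp n G \<Longrightarrow> cscale c U \<in> gsp n G" for U :: "nat set \<Rightarrow> 'k"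
  by (simp add: gsp_iff) (simp add: cscale_def)

lemma gsp_uminus: "U \<in> gsp n G \<Longrightarrow> - U \<in> gsp n G" for U :: "nat set \<Rightarrow> 'k"
  unfolding uminus_eq_cscale by (rule gsp_cscale)

text \<open>Encoding subspaces by sets of grades turns sums into unions. The sets may overlap;
  common grades are assigned to the first summand.\<close>

lemma dsum_gsp: "(gsp n G :: (nat set \<Rightarrow> 'k) set) \<oplus>\<^sub>C gsp n H = gsp n (G \<union> H)"
proof (intro equalityI subsetI)
  fix U :: "nat set \<Rightarrow> 'k" assume "U \<in> gsp n G \<oplus>\<^sub>C gsp n H"
  then obtain V W where U: "U = V + W" and V: "V \<in> gsp n G" and W: "W \<in> gsp n H"
    by (auto simp: dsum_def plus_fun_def)
  from V W show "U \<in> gsp n (G \<union> H)"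
    unfolding U by (simp add: gsp_iff Cl_add)
next
  fix U :: "nat set \<Rightarrow> 'k" assume U: "U \<in> gsp n (G \<union> H)"
  define V where "V = (\<lambda>A. if card A \<in> G then U A else 0)"
  define W where "W = (\<lambda>A. if card A \<in> G then 0 else U A)"
  have "U = (\<lambda>A. V A + W A)" by (auto simp: V_def W_def)
  moreover have "V \<in> gsp n G" "W \<in> gsp n H"
    using U by (auto simp: gsp_def Cl_def V_def W_def split: if_splits)
  ultimately show "U \<in> gsp n G \<oplus>\<^sub>C gsp n H" by (auto simp: dsum_def)
qed

lemma gsp_cmul:
  assumes "\<And>A B. A \<subseteq> I \<Longrightarrow> B \<subseteq> I \<Longrightarrow> card A \<in> G \<Longrightarrow> card B \<in> H \<Longrightarrow> card (sym_diff A B) \<in> K"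
    and "U \<in> gsp n G" "V \<in> gsp n H"
  shows "U \<star> V \<in> gsp n K"
  unfolding gsp_iff
proof (intro conjI allI impI cmul_in_Cl)
  fix C assume "C \<subseteq> I" "card C \<notin> K"
  have "U A = 0 \<or> V B = 0 \<or> sym_diff A B \<noteq> C" if "A \<subseteq> I" "B \<subseteq> I" for A B
    using assms that \<open>card C \<notin> K\<close> unfolding gsp_iff by blast
  then show "(U \<star> V) C = 0"
    unfolding cmul_altdef by (intro sum.neutral ballI) auto
qed

subsection \<open>The exponential\<close>

definition l1 :: "(nat set \<Rightarrow> 'k) \<Rightarrow> real" where
  "l1 U = (\<Sum>A\<in>Pow I. norm (U A))"

lemma l1_nonneg: "l1 U \<ge> 0"
  by (simp add: l1_def sum_nonneg)

lemma norm_le_l1: "U \<in> Cl n \<Longrightarrow> norm (U A) \<le> l1 U"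
proof (cases "A \<subseteq> I")
  case True
  then show ?thesis unfolding l1_def by (intro member_le_sum) auto
next
  case False
  moreover assume "U \<in> Cl n"
  ultimately have "U A = 0" unfolding Cl_def by blast
  then show ?thesis by (simp add: l1_nonneg)
qed

text \<open>A pair of blades contributes to a single target blade, with a coefficient of norm 1, so
  summing over targets recovers the plain product of the two sums.\<close>

lemma l1_cmul: "l1 (U \<star> V) \<le> l1 U * l1 V"
proof -
  have "l1 (U \<star> V) \<le> (\<Sum>C\<in>Pow I. \<Sum>A\<in>Pow I. \<Sum>B\<in>Pow I.
      norm (U A) * norm (V B) * (if sym_diff A B = C then 1 else 0))"
    unfolding l1_def cmul_altdef
    by (intro sum_mono order.trans[OF norm_sum] order.trans[OF norm_sum]) (simp add: norm_mult)
  also have "\<dots> = (\<Sum>A\<in>Pow I. \<Sum>B\<in>Pow I. \<Sum>C\<in>Pow I.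
      norm (U A) * norm (V B) * (if sym_diff A B = C then 1 else 0))"
    by (subst sum.swap, rule sum.cong[OF refl], rule sum.swap)
  also have "\<dots> = (\<Sum>A\<in>Pow I. \<Sum>B\<in>Pow I. norm (U A) * norm (V B))"
  proof (intro sum.cong refl)
    fix A B assume "A \<in> Pow I" "B \<in> Pow I"
    then have "sym_diff A B \<in> Pow I" by auto
    then show "(\<Sum>C\<in>Pow I. norm (U A) * norm (V B) * (if sym_diff A B = C then 1 else 0))
        = norm (U A) * norm (V B)"
      by (subst sum_distrib_left[symmetric], subst sum.delta') auto
  qed
  also have "\<dots> = l1 U * l1 V" unfolding l1_def by (simp add: sum_product)
  finally show ?thesis .
qed

lemma l1_cscale: "l1 (cscale c U) = norm c * l1 U"
  by (simp add: l1_def cscale_def norm_mult sum_distrib_left)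

lemma l1_cone: "l1 cone = 1"
proof -
  have "l1 cone = (\<Sum>A\<in>Pow I. if A = {} then 1 else 0)"
    unfolding l1_def cone_def by (intro sum.cong) auto
  then show ?thesis by simp
qed

lemma cpow_in_Cl [simp]: "cpow n eta U k \<in> Cl n"
  by (cases k) simp_all

lemma l1_cpow: "l1 (cpow n eta U k) \<le> l1 U ^ k"
proof (induction k)
  case (Suc k)
  have "l1 (U \<star> cpow n eta U k) \<le> l1 U * l1 (cpow n eta U k)" by (rule l1_cmul)
  also have "\<dots> \<le> l1 U * l1 U ^ k" using Suc by (intro mult_left_mono l1_nonneg)
  finally show ?case by simp
qed (simp add: l1_cone)

definition exp_term :: "(nat set \<Rightarrow> 'k) \<Rightarrow> nat \<Rightarrow> nat set \<Rightarrow> 'k" where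
  "exp_term U k = cscale (1 / fact k) (cpow n eta U k)"

lemma exp_term_in_Cl [simp]: "exp_term U k \<in> Cl n"
  by (simp add: exp_term_def)

lemma cexp_altdef: "cexp n eta U A = (\<Sum>k. exp_term U k A)"
  by (simp add: cexp_def exp_term_def cscale_def)

lemma l1_exp_term: "l1 (exp_term U k) \<le> l1 U ^ k / fact k"
  using l1_cpow[of U k] by (simp add: exp_term_def l1_cscale norm_divide divide_right_mono)

lemma summable_l1_power: "summable (\<lambda>k. l1 U ^ k / fact k)"
  using summable_exp[of "l1 U"] by (simp add: field_simps)

lemma exp_term_summable: "summable (\<lambda>k. norm (exp_term U k A))"
proof (rule summable_comparison_test'[OF summable_l1_power[of U], of 0])
  fix k show "norm (norm (exp_term U k A)) \<le> l1 U ^ k / fact k"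
    using norm_le_l1[OF exp_term_in_Cl, of U k A] l1_exp_term[of U k] by simp
qed

lemma exp_term_cmul_summable: "summable (\<lambda>k. norm ((exp_term U k \<star> W) A))"
proof (rule summable_comparison_test'[OF summable_mult2[OF summable_l1_power[of U]], of 0])
  fix k
  have "norm ((exp_term U k \<star> W) A) \<le> l1 (exp_term U k \<star> W)" by (rule norm_le_l1) simp
  also have "\<dots> \<le> l1 (exp_term U k) * l1 W" by (rule l1_cmul)
  also have "\<dots> \<le> l1 U ^ k / fact k * l1 W" by (intro mult_right_mono l1_exp_term l1_nonneg)
  finally show "norm (norm ((exp_term U k \<star> W) A)) \<le> l1 U ^ k / fact k * l1 W" by simp
qed

lemma sum_apply: "(\<Sum>i\<in>J. f i) A = (\<Sum>i\<in>J. f i A)" for f :: "nat \<Rightarrow> nat set \<Rightarrow> 'k"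
  by (induction J rule: infinite_finite_induct) simp_all

text \<open>A coordinate of the product is a finite combination of products of scalar series, so the
  scalar Cauchy product suffices and no norm on the algebra is involved.\<close>

lemma cmul_sums:
  assumes "\<And>A. summable (\<lambda>k. norm (a k A))" "\<And>A. summable (\<lambda>k. norm (b k A))"
  shows "(\<lambda>k. (\<Sum>i\<le>k. a i \<star> b (k - i)) C) sums (((\<lambda>A. \<Sum>k. a k A) \<star> (\<lambda>A. \<Sum>k. b k A)) C)"
proof -
  let ?d = "\<lambda>A B. if sym_diff A B = C then 1 else (0::'k)"
  have "(\<lambda>k. \<Sum>A\<in>Pow I. \<Sum>B\<in>Pow I. bc A B * ?d A B * (\<Sum>i\<le>k. a i A * b (k - i) B)) sums
    (\<Sum>A\<in>Pow I. \<Sum>B\<in>Pow I. bc A B * ?d A B * ((\<Sum>k. a k A) * (\<Sum>k. b k B)))"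
    by (intro sums_sum sums_mult Cauchy_product_sums assms)
  moreover have "(\<Sum>A\<in>Pow I. \<Sum>B\<in>Pow I. bc A B * ?d A B * (\<Sum>i\<le>k. a i A * b (k - i) B))
    = (\<Sum>i\<le>k. a i \<star> b (k - i)) C" for k
  proof -
    have "(\<Sum>i\<le>k. a i \<star> b (k - i)) C =
      (\<Sum>i\<le>k. \<Sum>A\<in>Pow I. \<Sum>B\<in>Pow I. bc A B * a i A * b (k - i) B * ?d A B)"
      unfolding sum_apply cmul_altdef ..
    also have "\<dots> = (\<Sum>A\<in>Pow I. \<Sum>B\<in>Pow I. \<Sum>i\<le>k. bc A B * a i A * b (k - i) B * ?d A B)"
      by (subst sum.swap, rule sum.cong[OF refl], rule sum.swap)
    finally show ?thesis
      by (simp only: sum_distrib_left mult_ac)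
  qed
  moreover have "(\<Sum>A\<in>Pow I. \<Sum>B\<in>Pow I. bc A B * ?d A B * ((\<Sum>k. a k A) * (\<Sum>k. b k B)))
    = ((\<lambda>A. \<Sum>k. a k A) \<star> (\<lambda>A. \<Sum>k. b k A)) C"
    unfolding cmul_altdef by (simp only: mult_ac)
  ultimately show ?thesis by (simp only:)
qed

text \<open>The coefficient of \<open>t\<^sup>k\<close> in \<open>exp(tX) W exp(tY)\<close>. Its recursion yields at once the addition
  theorem for commuting exponents, the invariance of subspaces under conjugation by exponentials,
  and the derivative at \<open>t = 0\<close>.\<close>

definition exp_conv where
  "exp_conv X W Y k = (\<Sum>i\<le>k. exp_term X i \<star> W \<star> exp_term Y (k - i))"

lemma exp_conv_sums:
  "(\<lambda>k. exp_conv X W Y k C) sums ((cexp n eta X \<star> W \<star> cexp n eta Y) C)"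
proof -
  \<comment> \<open>The middle factor acts on coordinates by a finite linear map, hence it can be
    absorbed into the left series, leaving a Cauchy product of two series.\<close>
  have W: "cexp n eta X \<star> W = (\<lambda>A. \<Sum>k. (exp_term X k \<star> W) A)"
  proof
    fix C :: "nat set"
    let ?d = "\<lambda>A B. if sym_diff A B = C then 1 else (0::'k)"
    have "(\<lambda>k. \<Sum>A\<in>Pow I. \<Sum>B\<in>Pow I. (bc A B * W B * ?d A B) * exp_term X k A)
      sums (\<Sum>A\<in>Pow I. \<Sum>B\<in>Pow I. (bc A B * W B * ?d A B) * (\<Sum>k. exp_term X k A))"
      by (intro sums_sum sums_mult summable_sums summable_norm_cancel[OF exp_term_summable])
    then show "(cexp n eta X \<star> W) C = (\<Sum>k. (exp_term X k \<star> W) C)"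
      unfolding cmul_altdef cexp_altdef by (simp only: sums_iff mult_ac)
  qed
  have "cexp n eta Y = (\<lambda>A. \<Sum>k. exp_term Y k A)" by (rule ext) (rule cexp_altdef)
  then show ?thesis
    unfolding W exp_conv_def
    using cmul_sums[of "\<lambda>k. exp_term X k \<star> W" "exp_term Y"]
    by (simp only: exp_term_cmul_summable exp_term_summable)
qed

lemma cscale_cscale: "cscale a (cscale b U) = cscale (a * b) U" for U :: "nat set \<Rightarrow> 'k"
  by (simp add: cscale_def mult.assoc)

lemma cscale_one [simp]: "cscale 1 U = U" for U :: "nat set \<Rightarrow> 'k"
  by (simp add: cscale_def)

lemma exp_term_0 [simp]: "exp_term X 0 = cone"
  by (simp add: exp_term_def)

lemma exp_term_Suc_left: "X \<star> exp_term X k = cscale (of_nat (Suc k)) (exp_term X (Suc k))"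
proof -
  have "of_nat (Suc k) * (1 / fact (Suc k)) = (1 / fact k :: 'k)"
    by (simp add: field_simps del: of_nat_Suc)
  then show ?thesis by (simp add: exp_term_def cmul_scale_right cscale_cscale del: of_nat_Suc fact_Suc)
qed

lemma cpow_commute:
  assumes "X \<star> Y = Y \<star> X" "X \<in> Cl n"
  shows "X \<star> cpow n eta Y k = cpow n eta Y k \<star> X"
proof (induction k)
  case (Suc k)
  then show ?case by (simp add: cmul_assoc) (metis assms(1) cmul_assoc)
qed (simp add: assms)

lemma exp_term_commute:
  assumes "X \<star> Y = Y \<star> X" "X \<in> Cl n"
  shows "X \<star> exp_term Y k = exp_term Y k \<star> X"
  by (simp add: exp_term_def cmul_scale_left cmul_scale_right cpow_commute assms)

lemma exp_term_Suc_right: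
  "X \<in> Cl n \<Longrightarrow> exp_term X k \<star> X = cscale (of_nat (Suc k)) (exp_term X (Suc k))"
  by (metis exp_term_Suc_left exp_term_commute)

lemma exp_conv_0: "W \<in> Cl n \<Longrightarrow> exp_conv X W Y 0 = W"
  by (simp add: exp_conv_def)

text \<open>This is the differential equation F' = X F + F Y for F(t) = exp(tX) W exp(tY), read off
  on Taylor coefficients.\<close>

lemma exp_conv_Suc:
  assumes "Y \<in> Cl n"
  shows "cscale (of_nat (Suc k)) (exp_conv X W Y (Suc k)) = X \<star> exp_conv X W Y k + exp_conv X W Y k \<star> Y"
proof
  fix C
  define g where "g i = (exp_term X i \<star> W \<star> exp_term Y (Suc k - i)) C" for i
  have "(X \<star> exp_conv X W Y k) C = (\<Sum>i\<le>k. X \<star> exp_term X i \<star> W \<star> exp_term Y (k - i)) C"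
    by (simp only: exp_conv_def cmul_sum_right cmul_assoc)
  also have "\<dots> = (\<Sum>i\<le>k. of_nat (Suc i) * g (Suc i))"
    unfolding sum_apply exp_term_Suc_left cmul_scale_left by (simp only: g_def cscale_def diff_Suc_Suc)
  also have "\<dots> = (\<Sum>i\<le>Suc k. of_nat i * g i)"
    by (subst sum.atMost_Suc_shift) simp
  finally have 1: "(X \<star> exp_conv X W Y k) C = (\<Sum>i\<le>Suc k. of_nat i * g i)" .
  have "(exp_conv X W Y k \<star> Y) C = (\<Sum>i\<le>k. exp_term X i \<star> W \<star> (exp_term Y (k - i) \<star> Y)) C"
    by (simp only: exp_conv_def cmul_sum_left cmul_assoc)
  also have "\<dots> = (\<Sum>i\<le>k. of_nat (Suc k - i) * g i)"
    unfolding sum_apply exp_term_Suc_right[OF assms] cmul_scale_right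
    by (intro sum.cong refl) (simp add: g_def cscale_def Suc_diff_le)
  \<comment> \<open>The added index \<open>Suc k\<close> has weight 0, as index 0 has in the first
    sum. The weights \<open>i\<close> and \<open>Suc k - i\<close> then add up to
    \<open>Suc k\<close> in every term.\<close>
  also have "\<dots> = (\<Sum>i\<le>Suc k. of_nat (Suc k - i) * g i)" by simp
  finally have 2: "(exp_conv X W Y k \<star> Y) C = (\<Sum>i\<le>Suc k. of_nat (Suc k - i) * g i)" .
  have "(X \<star> exp_conv X W Y k + exp_conv X W Y k \<star> Y) C = (\<Sum>i\<le>Suc k. of_nat (Suc k) * g i)"
    unfolding plus_fun_apply 1 2 sum.distrib[symmetric] distrib_right[symmetric] of_nat_add[symmetric]
    by (intro sum.cong refl) simp
  then show "cscale (of_nat (Suc k)) (exp_conv X W Y (Suc k)) C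
      = (X \<star> exp_conv X W Y k + exp_conv X W Y k \<star> Y) C"
    by (simp only: cscale_def exp_conv_def sum_apply g_def sum_distrib_left)
qed

lemma cscale_of_nat_cancel:
  "cscale (of_nat (Suc k)) U = cscale (of_nat (Suc k)) V \<Longrightarrow> U = V" for U V :: "nat set \<Rightarrow> 'k"
  by (simp add: cscale_def fun_eq_iff del: of_nat_Suc)

text \<open>Both sides start at \<open>cone\<close> and obey the same recursion, since
  \<open>Y\<close> commutes with the terms of the series of \<open>X + Y\<close>; this replaces the
  binomial theorem.\<close>

lemma exp_conv_commuting:
  assumes "X \<star> Y = Y \<star> X" "X \<in> Cl n" "Y \<in> Cl n"
  shows "exp_conv X cone Y k = exp_term (X + Y) k"
proof (induction k)
  case (Suc k)
  have "Y \<star> (X + Y) = (X + Y) \<star> Y" by (simp only: cmul_add_left cmul_add_right assms)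
  then have "exp_term (X + Y) k \<star> Y = Y \<star> exp_term (X + Y) k"
    using exp_term_commute assms(3) by metis
  then have "cscale (of_nat (Suc k)) (exp_conv X cone Y (Suc k)) = (X + Y) \<star> exp_term (X + Y) k"
    by (simp only: exp_conv_Suc assms Suc cmul_add_left)
  then show ?case by (simp only: exp_term_Suc_left) (rule cscale_of_nat_cancel)
qed (simp add: exp_conv_0)

lemma cexp_in_Cl [simp]: "cexp n eta X \<in> Cl n"
proof -
  have "cexp n eta X A = 0" if "\<not> A \<subseteq> I" for A
  proof -
    have "exp_term X k A = 0" for k using exp_term_in_Cl[of X k] that unfolding Cl_def by blast
    then show ?thesis by (simp add: cexp_altdef)
  qed
  then show ?thesis unfolding Cl_def by blast
qed

lemma cexp_add:
  assumes "X \<star> Y = Y \<star> X" "X \<in> Cl n" "Y \<in> Cl n"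
  shows "cexp n eta X \<star> cexp n eta Y = cexp n eta (X + Y)"
proof
  fix C
  have "(\<lambda>k. exp_term (X + Y) k C) sums ((cexp n eta X \<star> cone \<star> cexp n eta Y) C)"
    using exp_conv_sums[of X cone Y C] by (simp only: exp_conv_commuting[OF assms])
  then show "(cexp n eta X \<star> cexp n eta Y) C = cexp n eta (X + Y) C"
    unfolding cexp_altdef[of "X + Y"] by (simp add: sums_iff)
qed

section \<open>Scaling the exponents and differentiating at zero\<close>

lemma cpow_cscale: "cpow n eta (cscale z X) k = cscale (z ^ k) (cpow n eta X k)"
  by (induction k) (simp_all add: cmul_scale_left cmul_scale_right cscale_cscale mult.commute)

lemma exp_term_cscale: "exp_term (cscale z X) k = cscale (z ^ k) (exp_term X k)"
  by (simp add: exp_term_def cpow_cscale cscale_cscale mult.commute)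

lemma exp_conv_cscale: "exp_conv (cscale z X) W (cscale z Y) k = cscale (z ^ k) (exp_conv X W Y k)"
proof
  fix C
  have "(exp_term (cscale z X) i \<star> W \<star> exp_term (cscale z Y) (k - i)) C
    = z ^ k * (exp_term X i \<star> W \<star> exp_term Y (k - i)) C" if "i \<le> k" for i
  proof -
    have "z ^ k = z ^ i * z ^ (k - i)" using that by (simp flip: power_add)
    then show ?thesis
      by (simp only: exp_term_cscale cmul_scale_left cmul_scale_right cscale_cscale) (simp only: cscale_def mult_ac)
  qed
  then show "exp_conv (cscale z X) W (cscale z Y) k C = cscale (z ^ k) (exp_conv X W Y k) C"
    unfolding exp_conv_def cscale_def sum_apply sum_distrib_left by (intro sum.cong refl) (simp add: cscale_def)
qed

text \<open>Over the complex field the hypothesis covers only the real line. The derivative exists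
  in \<open>'k\<close>, and its value is already determined by a sequence of real points.\<close>

lemma powser_vanishing_on_reals:
  fixes c :: "nat \<Rightarrow> 'k"
  assumes "\<And>z. summable (\<lambda>k. c k * z ^ k)" and "\<And>t::real. (\<Sum>k. c k * of_real t ^ k) = 0"
  shows "c 1 = 0"
proof -
  define F where "F z = (\<Sum>k. c k * z ^ k)" for z
  have "(F has_field_derivative (\<Sum>k. diffs c k * 0 ^ k)) (at 0)"
    unfolding F_def by (rule termdiffs_strong_converges_everywhere) (rule assms)
  moreover have "(\<Sum>k. diffs c k * 0 ^ k) = c 1"
    by (simp add: powser_zero diffs_def)
  ultimately have "(\<lambda>h. (F (0 + h) - F 0) / h) \<midarrow>0\<rightarrow> c 1"
    by (simp add: DERIV_def)
  \<comment> \<open>The reciprocals of positive integers tend to 0 without reaching it, as the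
    punctured limit requires.\<close>
  moreover have "filterlim (\<lambda>m. of_real (inverse (real (Suc m))) :: 'k) (at 0) sequentially"
  proof (rule filterlim_atI)
    show "(\<lambda>m. of_real (inverse (real (Suc m))) :: 'k) \<longlonglongrightarrow> 0"
      using tendsto_of_real[OF LIMSEQ_inverse_real_of_nat, where 'a = 'k] by (simp only: of_real_0)
  qed (simp del: of_nat_Suc)
  ultimately have "(\<lambda>m. (F (0 + of_real (inverse (real (Suc m)))) - F 0) / of_real (inverse (real (Suc m))))
      \<longlonglongrightarrow> c 1"
    by (rule filterlim_compose)
  moreover have "F (of_real t) = 0" for t :: real using assms(2) by (simp add: F_def)
  moreover from this[of 0] have "F 0 = 0" by simp
  ultimately have "(\<lambda>m. 0) \<longlonglongrightarrow> c 1"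
    by (simp only: add_0 diff_self div_0)
  then show ?thesis by (simp add: LIMSEQ_const_iff)
qed

abbreviation scl :: "real \<Rightarrow> (nat set \<Rightarrow> 'k) \<Rightarrow> nat set \<Rightarrow> 'k" where
  "scl t \<equiv> cscale (of_real t)"

text \<open>A coordinate outside \<open>G\<close> is a power series in \<open>t\<close> vanishing
  for real \<open>t\<close>, and its linear coefficient is that coordinate of
  \<open>X \<star> W + W \<star> Y\<close>.\<close>

lemma exp_conj_derivative:
  assumes "\<And>t. cexp n eta (scl t X) \<star> W \<star> cexp n eta (scl t Y) \<in> gsp n G" "W \<in> Cl n" "Y \<in> Cl n"
  shows "X \<star> W + W \<star> Y \<in> gsp n G"
  unfolding gsp_iff
proof (intro conjI allI impI Cl_add cmul_in_Cl)
  fix C assume C: "C \<subseteq> I" "card C \<notin> G"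
  have sums: "(\<lambda>k. exp_conv X W Y k C * z ^ k) sums ((cexp n eta (cscale z X) \<star> W \<star> cexp n eta (cscale z Y)) C)" for z
    using exp_conv_sums[of "cscale z X" W "cscale z Y" C]
    unfolding exp_conv_cscale cscale_def[of "_ ^ _"] by (simp only: mult.commute)
  have "exp_conv X W Y 1 C = 0"
  proof (rule powser_vanishing_on_reals)
    show "summable (\<lambda>k. exp_conv X W Y k C * z ^ k)" for z using sums sums_summable by blast
    show "(\<Sum>k. exp_conv X W Y k C * of_real t ^ k) = 0" for t
      using sums[of "of_real t"] assms(1)[of t] C by (simp add: sums_iff gsp_iff)
  qed
  moreover have "exp_conv X W Y 1 = X \<star> W + W \<star> Y"
    using exp_conv_Suc[OF assms(3), of 0 X W] by (simp add: exp_conv_0 assms)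
  ultimately show "(X \<star> W + W \<star> Y) C = 0" by simp
qed


subsection \<open>Centre and commutation\<close>

lemma cmul_commuteI:
  assumes "\<And>A B. A \<subseteq> I \<Longrightarrow> B \<subseteq> I \<Longrightarrow> U A \<noteq> 0 \<Longrightarrow> V B \<noteq> 0 \<Longrightarrow> even (card A * card B + card (A \<inter> B))"
  shows "U \<star> V = V \<star> U"
proof
  fix C
  have "(V \<star> U) C = (\<Sum>A\<in>Pow I. \<Sum>B\<in>Pow I. bc B A * V B * U A * (if sym_diff B A = C then 1 else 0))"
    unfolding cmul_altdef by (rule sum.swap)
  also have "\<dots> = (U \<star> V) C"
    unfolding cmul_altdef
  proof (intro sum.cong refl)
    fix A B assume AB: "A \<in> Pow I" "B \<in> Pow I"
    then have fin: "finite A" "finite B" by (auto intro: finite_subset)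
    have "bc B A * V B * U A = bc A B * U A * V B"
    proof (cases "U A = 0 \<or> V B = 0")
      case False
      with AB have "even (card A * card B + card (A \<inter> B))" by (intro assms) auto
      then show ?thesis by (simp add: blade_coeff_swap[OF fin])
    qed auto
    then show "bc B A * V B * U A * (if sym_diff B A = C then 1 else 0)
        = bc A B * U A * V B * (if sym_diff A B = C then 1 else 0)"
      by (simp add: Un_commute)
  qed
  finally show "(U \<star> V) C = (V \<star> U) C" by simp
qed

text \<open>One set of grades for both parities of \<open>n\<close>: the case distinction in
  \<open>Zc\<close> becomes a membership condition that arithmetic can decide.\<close>

definition Zg :: "nat set" where
  "Zg = {k. k = 0 \<or> k = n \<and> odd n}"

lemma card_eq_n_iff: "A \<subseteq> I \<Longrightarrow> card A = n \<longleftrightarrow> A = I"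
  using card_subset_eq[of I A] by auto

lemma card_eq_0_iff': "A \<subseteq> I \<Longrightarrow> card A = 0 \<longleftrightarrow> A = {}"
  using finite_subset[of A I] by auto

lemma Cgr_0_n: "(Cgr n 0 :: (nat set \<Rightarrow> 'k) set) \<oplus>\<^sub>C Cgr n n = gsp n {0, n}"
  unfolding Cgr_def dsum_gsp by (simp add: insert_commute)

lemma Zc_eq: "(Zc n :: (nat set \<Rightarrow> 'k) set) = gsp n Zg"
proof (cases "even n")
  case True
  then have "Zg = {0}" by (auto simp: Zg_def)
  with True show ?thesis by (simp add: Zc_def Cgr_def)
next
  case False
  then have "Zg = {0, n}" by (auto simp: Zg_def)
  with False show ?thesis by (simp add: Zc_def Cgr_0_n)
qed

text \<open>For the full blade with \<open>n\<close> odd the swap exponent is (n+1) times the size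
  of the other blade.\<close>

lemma center_commute:
  assumes "W \<in> gsp n Zg"
  shows "W \<star> V = V \<star> W"
proof (rule cmul_commuteI)
  fix A B assume AB: "A \<subseteq> I" "B \<subseteq> I" "W A \<noteq> 0" "V B \<noteq> 0"
  then have "card A \<in> Zg" using assms unfolding gsp_iff by blast
  then have "A = {} \<or> A = I \<and> odd n" using AB by (auto simp: Zg_def card_eq_n_iff card_eq_0_iff')
  then show "even (card A * card B + card (A \<inter> B))"
    using AB by (auto simp: Int_absorb1)
qed

text \<open>The swap exponent is again (n+1) times the size of the other blade; here evenness comes
  from that size. This handles Q' for even \<open>n\<close>.\<close>

lemma pseudoscalar_commute_even:
  assumes "W \<in> gsp n {0, n}" "V \<in> gsp n {k. even k}"
  shows "W \<star> V = V \<star> W"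
proof (rule cmul_commuteI)
  fix A B assume AB: "A \<subseteq> I" "B \<subseteq> I" "W A \<noteq> 0" "V B \<noteq> 0"
  then have "card A \<in> {0, n}" "even (card B)" using assms unfolding gsp_iff by blast+
  moreover from this have "A = {} \<or> A = I" using AB by (auto simp: card_eq_n_iff card_eq_0_iff')
  ultimately show "even (card A * card B + card (A \<inter> B))"
    using AB by (auto simp: Int_absorb1)
qed

lemma blade_coeff_singleton_eq_iff:
  assumes "A \<subseteq> I"
  shows "bc A {i} = bc {i} A \<longleftrightarrow> (even (card A) \<longleftrightarrow> i \<notin> A)"
proof -
  have "finite A" using assms by (rule finite_subset) simp
  from blade_coeff_swap[OF this, of "{i}"]
  have "bc {i} A = (-1) ^ (card A + card (A \<inter> {i})) * bc A {i}" by simp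
  moreover have "card (A \<inter> {i}) = (if i \<in> A then 1 else 0)" by simp
  moreover have "bc A {i} \<noteq> - bc A {i}"
  proof
    assume "bc A {i} = - bc A {i}"
    then have "2 * bc A {i} = 0" unfolding mult_2 eq_neg_iff_add_eq_0 .
    then show False by simp
  qed
  ultimately show ?thesis
    by (cases "even (card A)"; cases "i \<in> A") (simp_all add: minus_one_power_iff)
qed

text \<open>As \<open>A\<close> determines \<open>sym_diff A {i}\<close> and conversely, a single
  coefficient of \<open>U\<close> can be isolated: it must vanish if the commutator does and the
  blade fails to commute with the generator.\<close>

lemma commutator_generator:
  assumes "A \<subseteq> I" "i < n"
  shows "(U \<star> blade {i} - blade {i} \<star> U) (sym_diff A {i}) = (bc A {i} - bc {i} A) * U A"
proof -
  have sub: "sym_diff A {i} \<subseteq> I" "{i} \<subseteq> I" using assms by auto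
  have inv: "sym_diff (sym_diff A {i}) {i} = A" by blast
  show ?thesis
    unfolding minus_apply cmul_blade_left[OF sub(2,1)] cmul_blade_right[OF sub(2,1)] inv
    by (rule left_diff_distrib[symmetric])
qed

text \<open>A blade occurring in \<open>V\<close> commutes with all generators, so whether
  \<open>i \<in> A\<close> depends only on the parity of \<open>card A\<close>. Hence
  \<open>A\<close> is empty, or full with \<open>n\<close> odd.\<close>

lemma centralI:
  assumes "V \<in> Cl n" "\<And>i. i < n \<Longrightarrow> V \<star> blade {i} = blade {i} \<star> V"
  shows "V \<in> gsp n Zg"
  unfolding gsp_iff
proof (intro conjI allI impI assms(1))
  fix A assume A: "A \<subseteq> I" "card A \<notin> Zg"
  show "V A = 0"
  proof (rule ccontr)
    assume "V A \<noteq> 0"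
    then have *: "even (card A) \<longleftrightarrow> i \<notin> A" if "i < n" for i
      using commutator_generator[OF A(1) that, of V] assms(2)[OF that]
        blade_coeff_singleton_eq_iff[OF A(1), of i] by simp
    have "A \<noteq> {}" using A by (auto simp: Zg_def)
    then obtain i where "i \<in> A" "i < n" using A(1) by (metis all_not_in_conv atLeastLessThan_iff subsetD)
    then have "odd (card A)" using *[of i] by auto
    then have "A = I" using A(1) * by auto
    then show False using A(2) \<open>odd (card A)\<close> by (simp add: Zg_def)
  qed
qed

text \<open>The condition quantifies over index sets because the size of a symmetric difference is
  not a function of the two sizes; \<open>{0, n}\<close> is closed only because a set of size
  \<open>n\<close> must be all of \<open>I\<close>.\<close>

definition mult_closed :: "nat set \<Rightarrow> bool" where
  "mult_closed G \<longleftrightarrow> 0 \<in> G \<and>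
    (\<forall>A B. A \<subseteq> I \<longrightarrow> B \<subseteq> I \<longrightarrow> card A \<in> G \<longrightarrow> card B \<in> G \<longrightarrow> card (sym_diff A B) \<in> G)"

lemma mult_closed_0_n: "mult_closed {0, n}"
  unfolding mult_closed_def
proof (intro conjI allI impI)
  fix A B assume AB: "A \<subseteq> I" "B \<subseteq> I" "card A \<in> {0, n}" "card B \<in> {0, n}"
  then have "A = {} \<or> A = I" "B = {} \<or> B = I" by (auto simp: card_eq_n_iff card_eq_0_iff')
  then show "card (sym_diff A B) \<in> {0, n}" by auto
qed simp

lemma mult_closed_0: "mult_closed {0}"
  unfolding mult_closed_def
proof (intro conjI allI impI)
  fix A B assume AB: "A \<subseteq> I" "B \<subseteq> I" "card A \<in> {0}" "card B \<in> {0}"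
  then have "A = {}" "B = {}" by (auto simp: card_eq_0_iff')
  then show "card (sym_diff A B) \<in> {0}" by auto
qed simp

lemma mult_closed_Zg: "mult_closed Zg"
proof (cases "even n")
  case True
  then have "Zg = {0}" by (auto simp: Zg_def)
  then show ?thesis using mult_closed_0 by simp
next
  case False
  then have "Zg = {0, n}" by (auto simp: Zg_def)
  then show ?thesis using mult_closed_0_n by simp
qed

lemma mult_closed_even: "mult_closed {k. even k}"
  unfolding mult_closed_def
proof (intro conjI allI impI)
  fix A B assume AB: "A \<subseteq> I" "B \<subseteq> I" "card A \<in> {k. even k}" "card B \<in> {k. even k}"
  have "card (sym_diff A B) + 2 * card (A \<inter> B) = card A + card B"
    by (rule card_sym_diff) (use AB in \<open>auto intro: finite_subset\<close>)
  then have "even (card (sym_diff A B) + 2 * card (A \<inter> B))" using AB by simp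
  then show "card (sym_diff A B) \<in> {k. even k}" by simp
qed simp

lemma mult_closed_cmul:
  "mult_closed G \<Longrightarrow> U \<in> gsp n G \<Longrightarrow> V \<in> gsp n G \<Longrightarrow> U \<star> V \<in> gsp n G"
  by (rule gsp_cmul[of G G G]) (auto simp: mult_closed_def)

lemma cexp_in_gsp:
  assumes "mult_closed G" "U \<in> gsp n G"
  shows "cexp n eta U \<in> gsp n G"
proof -
  have cpow: "cpow n eta U k \<in> gsp n G" for k
  proof (induction k)
    case 0
    show ?case using assms(1) by (auto simp: gsp_def mult_closed_def cone_def Cl_def)
  qed (simp add: mult_closed_cmul assms)
  show ?thesis
    unfolding gsp_iff
  proof (intro conjI allI impI cexp_in_Cl)
    fix A assume "A \<subseteq> I" "card A \<notin> G"
    then have "cpow n eta U k A = 0" for k using cpow[of k] by (simp add: gsp_iff)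
    then show "cexp n eta U A = 0" by (simp add: cexp_def)
  qed
qed

lemma exp_term_zero: "exp_term 0 k = (if k = 0 then cone else 0)"
  by (cases k) (auto simp: exp_term_def cscale_def fun_eq_iff)

lemma cexp_zero: "cexp n eta 0 = cone"
proof
  fix A
  have "cexp n eta 0 A = (\<Sum>k. if k = 0 then cone A else 0)"
    unfolding cexp_altdef exp_term_zero by (intro suminf_cong) auto
  also have "\<dots> = cone A" using sums_If_finite_set[of "{0}" "\<lambda>_. cone A :: 'k"] by (simp add: sums_iff)
  finally show "cexp n eta 0 A = cone A" .
qed

lemma cexp_uminus: "U \<in> Cl n \<Longrightarrow> cexp n eta U \<star> cexp n eta (- U) = cone"
  by (subst cexp_add) (simp_all add: cmul_minus_left cmul_minus_right cexp_zero)

lemma cexp_uminus': "U \<in> Cl n \<Longrightarrow> cexp n eta (- U) \<star> cexp n eta U = cone"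
  by (subst cexp_add) (simp_all add: cmul_minus_left cmul_minus_right cexp_zero)

lemma cexp_in_units: "U \<in> Cl n \<Longrightarrow> cexp n eta U \<in> units_in n eta S \<longleftrightarrow> cexp n eta U \<in> S"
  unfolding units_in_def using cexp_uminus[of U] cexp_uminus'[of U] cexp_in_Cl by blast

subsection \<open>One-parameter subgroups\<close>

text \<open>Commutation is assumed only under the linear condition, from which it is derived in each
  application. The direction towards that condition is pure differentiation.\<close>

lemma cexp_product_in_units_iff:
  assumes "mult_closed G" "X \<in> Cl n" "U \<in> Cl n" "X + U \<in> gsp n G \<Longrightarrow> X \<star> U = U \<star> X"
  shows "(\<forall>t. cexp n eta (scl t X) \<star> cexp n eta (scl t U) \<in> units_in n eta (gsp n G)) \<longleftrightarrow> X + U \<in> gsp n G"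
proof
  assume "\<forall>t. cexp n eta (scl t X) \<star> cexp n eta (scl t U) \<in> units_in n eta (gsp n G)"
  then have "cexp n eta (scl t X) \<star> cone \<star> cexp n eta (scl t U) \<in> gsp n G" for t
    by (simp add: units_in_def)
  from exp_conj_derivative[OF this] show "X + U \<in> gsp n G" using assms by simp
next
  assume XU: "X + U \<in> gsp n G"
  show "\<forall>t. cexp n eta (scl t X) \<star> cexp n eta (scl t U) \<in> units_in n eta (gsp n G)"
  proof
    fix t
    have "cexp n eta (scl t X) \<star> cexp n eta (scl t U) = cexp n eta (scl t X + scl t U)"
      using assms XU by (intro cexp_add) (simp_all add: cmul_scale_left cmul_scale_right)
    also have "scl t X + scl t U = scl t (X + U)"
      by (rule ext) (simp add: cscale_def distrib_left)
    finally have "cexp n eta (scl t X) \<star> cexp n eta (scl t U) = cexp n eta (scl t (X + U))" .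
    then show "cexp n eta (scl t X) \<star> cexp n eta (scl t U) \<in> units_in n eta (gsp n G)"
      using assms XU by (simp add: cexp_in_units cexp_in_gsp gsp_cscale Cl_add)
  qed
qed

lemma crev_cscale: "crev (cscale c U) = cscale c (crev U)" for U :: "nat set \<Rightarrow> 'k"
  by (simp add: crev_def cscale_def mult_ac)

lemma ghat_cscale: "ghat (cscale c U) = cscale c (ghat U)" for U :: "nat set \<Rightarrow> 'k"
  by (simp add: ghat_def cscale_def mult_ac)

lemma crev_cone: "crev cone = (cone :: nat set \<Rightarrow> 'k)"
  by (auto simp: crev_def cone_def)

lemma ghat_cone: "ghat cone = (cone :: nat set \<Rightarrow> 'k)"
  by (auto simp: ghat_def cone_def)

lemma cexp_summable: "summable (\<lambda>k. cpow n eta U k A / of_nat (fact k))"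
  using summable_norm_cancel[OF exp_term_summable[of U A]] by (simp add: exp_term_def cscale_def)

text \<open>The factor \<open>s A\<close> does not depend on the power \<open>k\<close>, so it comes
  out of the series. This covers both involutions.\<close>

lemma cexp_diagonal:
  assumes "\<And>k A. cpow n eta V k A = s A * cpow n eta U k A"
  shows "cexp n eta V A = s A * cexp n eta U A"
  unfolding cexp_def assms times_divide_eq_right[symmetric]
  by (rule suminf_mult[OF cexp_summable])

text \<open>Reversing the factors of a power is harmless, since powers of one element commute with
  it.\<close>

lemma crev_cexp:
  assumes "U \<in> Cl n"
  shows "crev (cexp n eta U) = cexp n eta (crev U)"
proof -
  have *: "cpow n eta (crev U) k = crev (cpow n eta U k)" for k
  proof (induction k)
    case (Suc k)
    then show ?case using assms by (simp add: crev_cmul cpow_commute flip: Suc)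
  qed (simp add: crev_cone)
  show ?thesis
    unfolding crev_def[of "cexp n eta U"]
    by (rule ext, rule cexp_diagonal[symmetric], unfold *) (rule fun_cong[OF crev_def])
qed

lemma ghat_cexp: "ghat (cexp n eta U) = cexp n eta (ghat U)"
proof -
  have *: "cpow n eta (ghat U) k = ghat (cpow n eta U k)" for k
    by (induction k) (simp_all add: ghat_cmul ghat_cone)
  show ?thesis
    unfolding ghat_def[of "cexp n eta U"]
    by (rule ext, rule cexp_diagonal[symmetric], unfold *) (rule fun_cong[OF ghat_def])
qed

lemma commute_of_central_sum:
  assumes "X + U \<in> gsp n Zg"
  shows "X \<star> U = U \<star> X"
proof -
  have "(X + U) \<star> U = U \<star> (X + U)" by (rule center_commute[OF assms])
  then show ?thesis by (simp add: cmul_add_left cmul_add_right)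
qed

lemma cexp_in_Agrp_iff:
  assumes "U \<in> Cl n"
  shows "(\<forall>t. cexp n eta (scl t U) \<in> Agrp n eta) \<longleftrightarrow> crev U + U \<in> gsp n Zg"
  using cexp_product_in_units_iff[OF mult_closed_Zg, of "crev U" U] assms
  by (simp add: Agrp_def cexp_in_units crev_cexp crev_cscale Zc_eq commute_of_central_sum)

lemma cexp_in_Bgrp_iff:
  assumes "U \<in> Cl n"
  shows "(\<forall>t. cexp n eta (scl t U) \<in> Bgrp n eta) \<longleftrightarrow> ghat (crev U) + U \<in> gsp n Zg"
  using cexp_product_in_units_iff[OF mult_closed_Zg, of "ghat (crev U)" U] assms
  by (simp add: Bgrp_def cexp_in_units crev_cexp crev_cscale ghat_cexp ghat_cscale Zc_eq commute_of_central_sum)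

text \<open>For \<open>T = W S\<close> with \<open>W\<close> central and \<open>S\<close> even or odd, \<open>T\<^sup>-\<^sup>1 ghat T = \<plusminus> W\<^sup>-\<^sup>1 ghat W\<close>.\<close>

lemma Pgrp_inverse_ghat_central:
  assumes "T \<in> Pgrp n eta" "T' \<star> T = cone" "T' \<in> Cl n"
  shows "T' \<star> ghat T \<in> gsp n Zg"
proof -
  obtain W S where T: "T = W \<star> S" and W: "W \<in> units_in n eta (Zc n)"
    and S: "S \<in> units_in n eta (Ceven n) \<union> units_in n eta (Codd n)"
    using assms(1) by (auto simp: Pgrp_def)
  from W obtain V where V: "V \<in> Cl n" "W \<star> V = cone" "V \<star> W = cone" and Wz: "W \<in> gsp n Zg"
    by (auto simp: units_in_def Zc_eq)
  \<comment> \<open>The inverse of a central element is central: for a generator b, V b = V b W V =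
    V W b V = b V.\<close>
  have "V \<in> gsp n Zg"
  proof (rule centralI[OF V(1)])
    fix i assume "i < n"
    then have B: "blade {i} \<in> Cl n" by (intro blade_in_Cl) auto
    have "V \<star> blade {i} = V \<star> (blade {i} \<star> W) \<star> V"
      using V B by (simp add: cmul_assoc)
    also have "\<dots> = V \<star> W \<star> blade {i} \<star> V"
      unfolding center_commute[OF Wz, of "blade {i}", symmetric] cmul_assoc ..
    finally show "V \<star> blade {i} = blade {i} \<star> V" using V B by simp
  qed
  have SCl: "S \<in> Cl n" using S by (auto simp: units_in_def)
  \<comment> \<open>Insert W V = 1 after \<open>S\<close> and move the central \<open>W\<close> to
    the left, which produces T' W S = T' T = 1.\<close>
  have "T' \<star> S = T' \<star> (S \<star> W) \<star> V" using SCl V by (simp add: cmul_assoc)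
  also have "\<dots> = V" using assms(2) V by (simp add: T center_commute[OF Wz, symmetric])
  finally have TS: "T' \<star> S = V" .
  have "ghat S = S \<or> ghat S = - S"
    using S
  proof
    assume "S \<in> units_in n eta (Ceven n)"
    then have "ghat S A = S A" for A
      by (cases "S A = 0") (auto simp: units_in_def Ceven_def gsp_def ghat_def)
    then show ?thesis by blast
  next
    assume "S \<in> units_in n eta (Codd n)"
    then have "ghat S A = - S A" for A
      by (cases "S A = 0") (auto simp: units_in_def Codd_def gsp_def ghat_def)
    then show ?thesis by (auto simp: fun_eq_iff)
  qed
  then have "T' \<star> ghat S = V \<or> T' \<star> ghat S = - V" using TS by (auto simp: cmul_minus_right)
  then have TS': "T' \<star> ghat S \<in> gsp n Zg" using \<open>V \<in> gsp n Zg\<close> gsp_uminus by auto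
  have gW: "ghat W \<in> gsp n Zg" using Wz by (simp add: gsp_iff) (simp add: ghat_def)
  have "T' \<star> ghat T = T' \<star> ghat W \<star> ghat S" by (simp add: T ghat_cmul cmul_assoc)
  also have "\<dots> = ghat W \<star> (T' \<star> ghat S)"
    by (simp add: center_commute[OF gW, symmetric] cmul_assoc)
  also have "\<dots> \<in> gsp n Zg" by (intro mult_closed_cmul mult_closed_Zg gW TS')
  finally show ?thesis .
qed

lemma cexp_in_Pgrp_iff:
  assumes "U \<in> Cl n"
  shows "(\<forall>t. cexp n eta (scl t U) \<in> Pgrp n eta) \<longleftrightarrow> - U + ghat U \<in> gsp n Zg"
proof
  assume P: "\<forall>t. cexp n eta (scl t U) \<in> Pgrp n eta"
  have "cexp n eta (scl t (- U)) \<star> cone \<star> cexp n eta (scl t (ghat U)) \<in> gsp n Zg" for t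
  proof -
    have "scl t (- U) = - scl t U" by (simp add: cscale_def fun_eq_iff)
    then have "cexp n eta (scl t (- U)) \<star> cexp n eta (scl t U) = cone"
      using assms by (simp add: cexp_uminus')
    then have "cexp n eta (scl t (- U)) \<star> ghat (cexp n eta (scl t U)) \<in> gsp n Zg"
      using P by (intro Pgrp_inverse_ghat_central) auto
    then show ?thesis by (simp add: ghat_cexp ghat_cscale)
  qed
  from exp_conj_derivative[OF this] show "- U + ghat U \<in> gsp n Zg" using assms by simp
next
  assume Z: "- U + ghat U \<in> gsp n Zg"
  \<comment> \<open>\<open>W\<close> is the odd part of \<open>U\<close>, central by hypothesis, and
    \<open>V\<close> is the even part. They give the two factors required in P.\<close>
  define W where "W = cscale (- 1 / 2) (- U + ghat U)"
  define V where "V = cscale (1 / 2) (U + ghat U)"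
  have W: "W \<in> gsp n Zg" unfolding W_def by (rule gsp_cscale[OF Z])
  have V: "V \<in> gsp n {k. even k}"
    using assms by (simp add: gsp_iff V_def Cl_add) (simp add: cscale_def ghat_def)
  have U: "U = W + V"
    by (rule ext) (simp add: W_def V_def cscale_def field_simps)
  show "\<forall>t. cexp n eta (scl t U) \<in> Pgrp n eta"
  proof
    fix t
    have Wt: "scl t W \<in> gsp n Zg" and Vt: "scl t V \<in> gsp n {k. even k}"
      using V W by (auto intro: gsp_cscale)
    have "scl t U = scl t W + scl t V"
      unfolding U by (rule ext) (simp add: cscale_def distrib_left)
    then have "cexp n eta (scl t U) = cexp n eta (scl t W + scl t V)" by simp
    also have "\<dots> = cexp n eta (scl t W) \<star> cexp n eta (scl t V)"
      by (rule cexp_add[symmetric, OF center_commute[OF Wt] gsp_in_Cl[OF Wt] gsp_in_Cl[OF Vt]])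
    finally have *: "cexp n eta (scl t U) = cexp n eta (scl t W) \<star> cexp n eta (scl t V)" .
    have "cexp n eta (scl t W) \<in> units_in n eta (Zc n)"
      using cexp_in_gsp[OF mult_closed_Zg Wt] gsp_in_Cl[OF Wt] by (simp add: cexp_in_units Zc_eq)
    moreover have "cexp n eta (scl t V) \<in> units_in n eta (Ceven n)"
      using cexp_in_gsp[OF mult_closed_even Vt] gsp_in_Cl[OF Vt] by (simp add: cexp_in_units Ceven_def)
    ultimately show "cexp n eta (scl t U) \<in> Pgrp n eta" unfolding * Pgrp_def by blast
  qed
qed


text \<open>The two conditions cannot be treated separately: for even \<open>n\<close> the
  commutation of \<open>crev U\<close> with \<open>U\<close> comes from the condition for P.\<close>

lemma cexp_in_Q'grp_iff:
  assumes U: "U \<in> Cl n"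
  shows "(\<forall>t. cexp n eta (scl t U) \<in> Q'grp n eta) \<longleftrightarrow>
    - U + ghat U \<in> gsp n Zg \<and> crev U + U \<in> gsp n {0, n}"
proof (cases "- U + ghat U \<in> gsp n Zg")
  case True
  have "crev U \<star> U = U \<star> crev U" if sum: "crev U + U \<in> gsp n {0, n}"
  proof (cases "even n")
    case False
    then have "Zg = {0, n}" by (auto simp: Zg_def)
    then show ?thesis using sum by (intro commute_of_central_sum) simp
  next
    case n: True
    \<comment> \<open>For even \<open>n\<close> the set \<open>Zg\<close> has no odd grade, and on
      odd grades \<open>- U + ghat U\<close> is \<open>- 2 * U\<close>.\<close>
    have "U \<in> gsp n {k. even k}"
      unfolding gsp_iff
    proof (intro conjI allI impI U)
      fix A assume A: "A \<subseteq> I" "card A \<notin> {k. even k}"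
      then have "card A \<notin> Zg" using n by (auto simp: Zg_def dest: odd_pos)
      then have "(- U + ghat U) A = 0" using True A unfolding gsp_iff by blast
      then show "U A = 0" using A(2) by (simp add: ghat_def)
    qed
    from pseudoscalar_commute_even[OF sum this] show ?thesis
      by (simp add: cmul_add_left cmul_add_right)
  qed
  from cexp_product_in_units_iff[OF mult_closed_0_n _ U this] U
  have "(\<forall>t. cexp n eta (scl t (crev U)) \<star> cexp n eta (scl t U) \<in> units_in n eta (gsp n {0, n}))
      \<longleftrightarrow> crev U + U \<in> gsp n {0, n}" by simp
  moreover have "\<forall>t. cexp n eta (scl t U) \<in> Pgrp n eta" using cexp_in_Pgrp_iff[OF U] True by blast
  ultimately show ?thesis
    using True U by (simp add: Q'grp_def crev_cexp crev_cscale Cgr_0_n)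
next
  case False
  then show ?thesis using cexp_in_Pgrp_iff[OF U] by (auto simp: Q'grp_def)
qed

section \<open>The Clifford group\<close>

lemma cinv_cexp:
  assumes "U \<in> Cl n"
  shows "cinv n eta (cexp n eta U) = cexp n eta (- U)"
  unfolding cinv_def
proof (rule the_equality)
  fix V assume V: "V \<in> Cl n \<and> cexp n eta U \<star> V = cone \<and> V \<star> cexp n eta U = cone"
  have "V = cexp n eta (- U) \<star> cexp n eta U \<star> V" using V assms by (simp add: cexp_uminus')
  also have "\<dots> = cexp n eta (- U)" using V by (simp add: cmul_assoc)
  finally show "V = cexp n eta (- U)" .
qed (simp add: assms cexp_uminus cexp_uminus')

text \<open>Each Taylor coefficient is the commutator of \<open>U\<close> with the preceding one,
  divided by its index, so invariance passes along the recursion to the sum.\<close>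

lemma conjugation_by_cexp:
  assumes comm: "\<And>X. X \<in> gsp n G \<Longrightarrow> U \<star> X - X \<star> U \<in> gsp n G" and U: "U \<in> Cl n" and X: "X \<in> gsp n G"
  shows "cexp n eta U \<star> X \<star> cexp n eta (- U) \<in> gsp n G"
proof -
  have conv: "exp_conv U X (- U) k \<in> gsp n G" for k
  proof (induction k)
    case 0
    then show ?case using X by (simp add: exp_conv_0 gsp_in_Cl)
  next
    case (Suc k)
    have "cscale (of_nat (Suc k)) (exp_conv U X (- U) (Suc k)) \<in> gsp n G"
      using comm[OF Suc] U by (subst exp_conv_Suc) (simp_all only: cmul_minus_right Cl_uminus add_uminus_conv_diff)
    then have "cscale (1 / of_nat (Suc k)) (cscale (of_nat (Suc k)) (exp_conv U X (- U) (Suc k))) \<in> gsp n G"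
      by (rule gsp_cscale)
    moreover have "1 / of_nat (Suc k) * of_nat (Suc k) = (1 :: 'k)" by (simp del: of_nat_Suc)
    ultimately show ?case by (simp only: cscale_cscale cscale_one)
  qed
  show ?thesis
    unfolding gsp_iff
  proof (intro conjI allI impI cmul_in_Cl)
    fix A assume "A \<subseteq> I" "card A \<notin> G"
    then have "exp_conv U X (- U) k A = 0" for k using conv[of k] by (simp add: gsp_iff)
    then show "(cexp n eta U \<star> X \<star> cexp n eta (- U)) A = 0"
      using exp_conv_sums[of U X "- U" A] by (simp add: sums_iff)
  qed
qed

lemma cexp_in_Gammagrp_iff:
  assumes U: "U \<in> Cl n"
  shows "(\<forall>t. cexp n eta (scl t U) \<in> Gammagrp n eta) \<longleftrightarrow>
    (\<forall>X\<in>gsp n {1}. U \<star> X - X \<star> U \<in> gsp n {1})"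
proof -
  have eq: "- scl t U = scl t (- U)" for t by (simp add: cscale_def fun_eq_iff)
  have iff: "(\<forall>t. cexp n eta (scl t U) \<in> Gammagrp n eta) \<longleftrightarrow>
      (\<forall>t. \<forall>X\<in>gsp n {1}. cexp n eta (scl t U) \<star> X \<star> cexp n eta (- scl t U) \<in> gsp n {1})"
    using U by (simp add: Gammagrp_def Cgr_def cexp_in_units cinv_cexp)
  show ?thesis
    unfolding iff
  proof (intro iffI ballI allI)
    fix X :: "nat set \<Rightarrow> 'k"
    assume *: "\<forall>t. \<forall>X\<in>gsp n {1}. cexp n eta (scl t U) \<star> X \<star> cexp n eta (- scl t U) \<in> gsp n {1}"
      and X: "X \<in> gsp n {1}"
    have "U \<star> X + X \<star> (- U) \<in> gsp n {1}"
      using * X gsp_in_Cl[OF X] U by (intro exp_conj_derivative) (simp_all add: eq)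
    then show "U \<star> X - X \<star> U \<in> gsp n {1}" by (simp add: cmul_minus_right)
  next
    fix t :: real and X :: "nat set \<Rightarrow> 'k"
    assume *: "\<forall>X\<in>gsp n {1}. U \<star> X - X \<star> U \<in> gsp n {1}" and X: "X \<in> gsp n {1}"
    show "cexp n eta (scl t U) \<star> X \<star> cexp n eta (- scl t U) \<in> gsp n {1}"
    proof (rule conjugation_by_cexp[OF _ _ X])
      fix Y :: "nat set \<Rightarrow> 'k" assume "Y \<in> gsp n {1}"
      then have "scl t (U \<star> Y - Y \<star> U) \<in> gsp n {1}" using * by (intro gsp_cscale) auto
      moreover have "scl t (U \<star> Y - Y \<star> U) = scl t U \<star> Y - Y \<star> scl t U"
        unfolding cmul_scale_left cmul_scale_right by (rule ext) (simp add: cscale_def right_diff_distrib)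
      ultimately show "scl t U \<star> Y - Y \<star> scl t U \<in> gsp n {1}" by simp
    qed (simp add: U)
  qed
qed

text \<open>To exclude a blade \<open>A\<close>, choose a generator anticommuting with it whose
  product has grade different from 1: an index inside \<open>A\<close> when the size is even and not
  0 or 2, an index outside when the size is odd and less than \<open>n\<close>.\<close>

lemma commutator_preserves_vectors_iff:
  assumes U: "U \<in> Cl n"
  shows "(\<forall>X\<in>gsp n {1}. U \<star> X - X \<star> U \<in> gsp n {1}) \<longleftrightarrow> U \<in> gsp n (insert 2 Zg)"
proof
  assume *: "\<forall>X\<in>gsp n {1}. U \<star> X - X \<star> U \<in> gsp n {1}"
  show "U \<in> gsp n (insert 2 Zg)"
    unfolding gsp_iff
  proof (intro conjI allI impI U)
    fix A assume A: "A \<subseteq> I" "card A \<notin> insert 2 Zg"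
    have fin: "finite A" using A(1) by (rule finite_subset) simp
    have key: "even (card A) \<longleftrightarrow> i \<notin> A" if nz: "U A \<noteq> 0" and "i < n" "card (sym_diff A {i}) \<noteq> 1" for i
    proof -
      have "blade {i} \<in> gsp n {1}" using \<open>i < n\<close> by (auto simp: gsp_def Cl_def blade_def)
      then have "U \<star> blade {i} - blade {i} \<star> U \<in> gsp n {1}" using * by blast
      then have "(U \<star> blade {i} - blade {i} \<star> U) (sym_diff A {i}) = 0"
        using that(3) unfolding gsp_def by blast
      then show ?thesis
        using commutator_generator[OF A(1) \<open>i < n\<close>, of U] nz blade_coeff_singleton_eq_iff[OF A(1), of i] by simp
    qed
    show "U A = 0"
    proof (rule ccontr)
      assume nz: "U A \<noteq> 0"
      show False
      proof (cases "even (card A)")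
        case True
        have "card A \<noteq> 0" using A(2) by (auto simp: Zg_def)
        then obtain i where i: "i \<in> A" by (metis card.empty ex_in_conv)
        then have "i < n" using A(1) by auto
        have "sym_diff A {i} = A - {i}" using i by auto
        then have "card (sym_diff A {i}) = card A - 1" using i fin by simp
        moreover have "card A \<noteq> 2" using A(2) by simp
        ultimately have "card (sym_diff A {i}) \<noteq> 1" by linarith
        from key[OF nz \<open>i < n\<close> this] show False using True i by simp
      next
        case False
        have "A \<noteq> I" using A(2) False by (auto simp: Zg_def)
        then obtain i where i: "i < n" "i \<notin> A"
          using A(1) by (metis atLeastLessThan_iff subsetI subset_antisym)
        then have "sym_diff A {i} = insert i A" by auto
        then have "card (sym_diff A {i}) = Suc (card A)" using i fin by simp
        then have "card (sym_diff A {i}) \<noteq> 1" using False by (metis One_nat_def Suc_inject even_zero)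
        from key[OF nz i(1) this] show False using False i by simp
      qed
    qed
  qed
next
  assume G: "U \<in> gsp n (insert 2 Zg)"
  show "\<forall>X\<in>gsp n {1}. U \<star> X - X \<star> U \<in> gsp n {1}"
  proof
    fix X :: "nat set \<Rightarrow> 'k" assume X: "X \<in> gsp n {1}"
    show "U \<star> X - X \<star> U \<in> gsp n {1}"
      unfolding gsp_iff
    proof (intro conjI allI impI)
      show "U \<star> X - X \<star> U \<in> Cl n"
        using Cl_add[OF cmul_in_Cl Cl_uminus[OF cmul_in_Cl]] by simp
      fix C assume C: "C \<subseteq> I" "card C \<notin> {1}"
      have "(X \<star> U) C = (\<Sum>A\<in>Pow I. \<Sum>B\<in>Pow I. bc B A * X B * U A * (if sym_diff B A = C then 1 else 0))"
        unfolding cmul_altdef by (rule sum.swap)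
      also have "\<dots> = (U \<star> X) C"
        unfolding cmul_altdef
      proof (intro sum.cong refl)
        fix A B assume AB: "A \<in> Pow I" "B \<in> Pow I"
        show "bc B A * X B * U A * (if sym_diff B A = C then 1 else 0)
            = bc A B * U A * X B * (if sym_diff A B = C then 1 else 0)"
        proof (cases "U A = 0 \<or> X B = 0 \<or> sym_diff A B \<noteq> C")
          case True
          then show ?thesis by (auto simp: Un_commute)
        next
          case False
          then have "card B = 1" "card A \<in> insert 2 Zg" using X G AB unfolding gsp_iff by blast+
          then obtain i where B: "B = {i}" by (auto simp: card_1_singleton_iff)
          have fin: "finite A" using AB finite_subset[of A I] by simp
          have "i < n" using B AB by simp
          have "even (card A) \<longleftrightarrow> i \<notin> A"
          proof (cases "card A = 2")
            case 2: True
            \<comment> \<open>Removing an index from a two-element set would place \<open>C\<close>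
              in grade 1. Thus all terms contributing outside grade 1 come from commuting
              blades.\<close>
            have "i \<notin> A"
            proof
              assume "i \<in> A"
              then have "sym_diff A B = A - {i}" using B by auto
              then have "C = A - {i}" using False by blast
              then have "card C = 1" using 2 \<open>i \<in> A\<close> fin by (simp add: card_Diff_singleton)
              then show False using C by simp
            qed
            then show ?thesis using 2 by simp
          next
            case not2: False
            with \<open>card A \<in> insert 2 Zg\<close> have "A = {} \<or> A = I \<and> odd n"
              using AB by (auto simp: Zg_def card_eq_n_iff card_eq_0_iff')
            then show ?thesis using \<open>i < n\<close> by auto
          qed
          then have "bc A B = bc B A"
            unfolding B using AB by (subst blade_coeff_singleton_eq_iff) auto
          then show ?thesis by (simp add: Un_commute)
        qed
      qed
      finally show "(U \<star> X - X \<star> U) C = 0" by simp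
    qed
  qed
qed

text \<open>Each coordinate is multiplied by 0 or by 2, and 2 is invertible. A general exponent
  \<open>f\<close> serves reversion, its composite with the grade involution, and the grade
  involution itself.\<close>

lemma symmetrized_in_gsp_iff:
  fixes U :: "nat set \<Rightarrow> 'k"
  assumes "U \<in> Cl n"
  shows "(\<lambda>A. (-1) ^ f (card A) * U A + U A) \<in> gsp n G \<longleftrightarrow> U \<in> gsp n (G \<union> {k. odd (f k)})"
proof -
  have "(\<lambda>A. (-1) ^ f (card A) * U A + U A) \<in> Cl n"
    using assms unfolding Cl_def mem_Collect_eq by (metis add_0 mult_zero_right)
  moreover have "(-1) ^ m * x + x = 0 \<longleftrightarrow> x = 0 \<or> odd m" for m and x :: 'k
    by (cases "even m") (simp_all flip: mult_2)
  ultimately show ?thesis using assms unfolding gsp_iff by auto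
qed

lemma triangular_parity: "odd (k * (k - 1) div 2) \<longleftrightarrow> k mod 4 = 2 \<or> k mod 4 = 3" for k :: nat
proof -
  obtain q r where k: "k = 4 * q + r" and r: "r < 4" by (metis mod_less_divisor mult_div_mod_eq zero_less_numeral)
  from r consider "r = 0" | "r = 1" | "r = 2" | "r = 3" by linarith
  then show ?thesis
  proof cases
    case 1
    then have "k * (k - 1) div 2 = 2 * (q * (4 * q - 1))" using k by simp
    then show ?thesis using 1 k by simp
  next
    case 2
    then have "k * (k - 1) div 2 = 2 * (q * (4 * q + 1))" using k by (simp add: algebra_simps)
    then show ?thesis using 2 k by (simp add: mod_Suc)
  next
    case 3
    then have "k * (k - 1) = 2 * ((2 * q + 1) * (4 * q + 1))" using k by (simp add: algebra_simps)
    then have "k * (k - 1) div 2 = (2 * q + 1) * (4 * q + 1)" by simp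
    then show ?thesis using 3 k by (simp add: mod_Suc)
  next
    case 4
    then have "k * (k - 1) = 2 * ((2 * q + 1) * (4 * q + 3))" using k by (simp add: algebra_simps)
    then have "k * (k - 1) div 2 = (2 * q + 1) * (4 * q + 3)" by simp
    then show ?thesis using 4 k by (simp add: mod_Suc)
  qed
qed

section \<open>The six Lie algebras as grade subspaces\<close>

lemma lie_eq_gspI: "lie n eta S = gsp n G"
  if "\<And>U. U \<in> Cl n \<Longrightarrow> (\<forall>t. cexp n eta (scl t U) \<in> S) \<longleftrightarrow> U \<in> gsp n G"
  using that gsp_in_Cl unfolding lie_def by blast

lemma crev_add_in_gsp_iff:
  fixes U :: "nat set \<Rightarrow> 'k"
  assumes "U \<in> Cl n"
  shows "crev U + U \<in> gsp n G \<longleftrightarrow> U \<in> gsp n (G \<union> {k. k mod 4 = 2 \<or> k mod 4 = 3})"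
  using symmetrized_in_gsp_iff[OF assms, of "\<lambda>k. k * (k - 1) div 2" G]
  unfolding triangular_parity by (simp add: crev_def plus_fun_def)

lemma ghat_crev_add_in_gsp_iff:
  fixes U :: "nat set \<Rightarrow> 'k"
  assumes "U \<in> Cl n"
  shows "ghat (crev U) + U \<in> gsp n G \<longleftrightarrow> U \<in> gsp n (G \<union> {k. k mod 4 = 1 \<or> k mod 4 = 2})"
proof -
  have "odd (k + k * (k - 1) div 2) \<longleftrightarrow> k mod 4 = 1 \<or> k mod 4 = 2" for k :: nat
    unfolding even_add using triangular_parity[of k] by presburger
  then show ?thesis
    using symmetrized_in_gsp_iff[OF assms, of "\<lambda>k. k + k * (k - 1) div 2" G]
    by (simp add: crev_def ghat_def plus_fun_def power_add mult.assoc)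
qed

lemma ghat_diff_in_gsp_iff:
  fixes U :: "nat set \<Rightarrow> 'k"
  assumes "U \<in> Cl n"
  shows "- U + ghat U \<in> gsp n G \<longleftrightarrow> U \<in> gsp n (G \<union> {k. even k})"
proof -
  have eq: "- (- U + ghat U) = (\<lambda>A. (-1) ^ Suc (card A) * U A + U A)"
    by (rule ext) (simp add: ghat_def)
  have "- U + ghat U \<in> gsp n G \<longleftrightarrow> - (- U + ghat U) \<in> gsp n G"
    using gsp_uminus[of "- U + ghat U" G] gsp_uminus[of "- (- U + ghat U)" G] by auto
  then show ?thesis
    unfolding eq using symmetrized_in_gsp_iff[OF assms, of Suc G] by simp
qed

lemma gsp_Int: "(gsp n G :: (nat set \<Rightarrow> 'k) set) \<inter> gsp n H = gsp n (G \<inter> H)"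
  by (auto simp: gsp_def)

lemma lie_Pgrp: "lie n eta (Pgrp n eta) = gsp n (Zg \<union> {k. even k})"
  by (rule lie_eq_gspI) (simp only: cexp_in_Pgrp_iff ghat_diff_in_gsp_iff)

lemma lie_Agrp: "lie n eta (Agrp n eta) = gsp n (Zg \<union> {k. k mod 4 = 2 \<or> k mod 4 = 3})"
  by (rule lie_eq_gspI) (simp add: cexp_in_Agrp_iff crev_add_in_gsp_iff)

lemma lie_Bgrp: "lie n eta (Bgrp n eta) = gsp n (Zg \<union> {k. k mod 4 = 1 \<or> k mod 4 = 2})"
  by (rule lie_eq_gspI) (simp add: cexp_in_Bgrp_iff ghat_crev_add_in_gsp_iff)

text \<open>Q and the intersection of A and P can differ only by invertibility in the whole algebra,
  which exponentials always have.\<close>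

lemma lie_Qgrp: "lie n eta (Qgrp n eta) = lie n eta (Agrp n eta) \<inter> lie n eta (Pgrp n eta)"
  by (auto simp: lie_def Qgrp_def Agrp_def cexp_in_units)

lemma lie_Q'grp:
  "lie n eta (Q'grp n eta) = gsp n ((Zg \<union> {k. even k}) \<inter> ({0, n} \<union> {k. k mod 4 = 2 \<or> k mod 4 = 3}))"
proof (rule lie_eq_gspI)
  fix U :: "nat set \<Rightarrow> 'k" assume U: "U \<in> Cl n"
  show "(\<forall>t. cexp n eta (scl t U) \<in> Q'grp n eta) \<longleftrightarrow>
      U \<in> gsp n ((Zg \<union> {k. even k}) \<inter> ({0, n} \<union> {k. k mod 4 = 2 \<or> k mod 4 = 3}))"
    unfolding cexp_in_Q'grp_iff[OF U] ghat_diff_in_gsp_iff[OF U] crev_add_in_gsp_iff[OF U] gsp_Int[symmetric]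
    by blast
qed

lemma lie_Gammagrp: "lie n eta (Gammagrp n eta) = gsp n (insert 2 Zg)"
  by (rule lie_eq_gspI) (simp only: cexp_in_Gammagrp_iff commutator_preserves_vectors_iff)


subsection \<open>Inclusions and dimensions\<close>

text \<open>For each \<open>k \<le> n\<close> the blade on the first \<open>k\<close> indices
  witnesses that grade \<open>k\<close> is nonzero, so inclusions of subspaces are statements about
  grades up to \<open>n\<close>.\<close>

lemma gsp_subset_iff:
  "(gsp n G :: (nat set \<Rightarrow> 'k) set) \<subseteq> gsp n H \<longleftrightarrow> (\<forall>k\<le>n. k \<in> G \<longrightarrow> k \<in> H)"
proof (intro iffI allI impI)
  fix k assume sub: "(gsp n G :: (nat set \<Rightarrow> 'k) set) \<subseteq> gsp n H" and k: "k \<le> n" "k \<in> G"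
  have "blade {0..<k} \<in> gsp n G" using k by (auto simp: gsp_def Cl_def blade_def)
  then have "blade {0..<k} \<in> gsp n H" using sub by blast
  moreover have "blade {0..<k} {0..<k} \<noteq> 0" by (simp add: blade_def)
  ultimately have "card {0..<k} \<in> H" unfolding gsp_def by blast
  then show "k \<in> H" by simp
next
  assume *: "\<forall>k\<le>n. k \<in> G \<longrightarrow> k \<in> H"
  have "card A \<le> n" if "A \<subseteq> I" for A using card_mono[OF _ that] by simp
  with * show "(gsp n G :: (nat set \<Rightarrow> 'k) set) \<subseteq> gsp n H"
    unfolding gsp_def Cl_def by blast
qed

lemma gsp_eq_iff:
  "(gsp n G :: (nat set \<Rightarrow> 'k) set) = gsp n H \<longleftrightarrow> (\<forall>k\<le>n. k \<in> G \<longleftrightarrow> k \<in> H)"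
  unfolding set_eq_subset gsp_subset_iff by blast

text \<open>This is the sum of the binomial coefficients of \<open>n\<close> over \<open>G\<close>;
  counting sets directly suits both the basis of blades and a recursion in \<open>n\<close>.\<close>

definition subset_count :: "nat set \<Rightarrow> nat" where
  "subset_count G = card {A \<in> Pow I. card A \<in> G}"

lemma cdim_gsp: "cdim (gsp n G :: (nat set \<Rightarrow> 'k) set) = subset_count G"
proof -
  interpret V: vector_space "cscale :: 'k \<Rightarrow> (nat set \<Rightarrow> 'k) \<Rightarrow> _"
    by standard (simp_all add: cscale_def fun_eq_iff algebra_simps)
  let ?T = "{A \<in> Pow I. card A \<in> G}"
  let ?B = "blade ` ?T"
  have fin: "finite ?T" by simp
  have inj: "inj_on blade ?T"
  proof (rule inj_onI)
    fix A B :: "nat set" assume "blade A = (blade B :: _ \<Rightarrow> 'k)"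
    from fun_cong[OF this, of A] show "A = B" by (simp add: blade_def split: if_splits)
  qed
  have app: "(\<Sum>b\<in>?B. cscale (f b) b) C = (if C \<in> ?T then f (blade C) else 0)" for f :: "_ \<Rightarrow> 'k" and C
  proof -
    have "(\<Sum>b\<in>?B. cscale (f b) b) C = (\<Sum>A\<in>?T. cscale (f (blade A)) (blade A)) C"
      by (subst sum.reindex[OF inj]) simp
    also have "\<dots> = (\<Sum>A\<in>?T. if A = C then f (blade C) else 0)"
    proof -
      have "(\<Sum>A\<in>S. cscale (f (blade A)) (blade A)) C = (\<Sum>A\<in>S. if A = C then f (blade C) else 0)" if "finite S" for S
        using that by (induction S) (auto simp: cscale_def blade_def)
      then show ?thesis using fin by blast
    qed
    also have "\<dots> = (if C \<in> ?T then f (blade C) else 0)" using fin by simp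
    finally show ?thesis .
  qed
  have "V.dim (gsp n G) = card ?T"
  proof (rule V.dim_unique)
    show "?B \<subseteq> gsp n G" by (auto simp: gsp_def Cl_def blade_def split: if_splits)
    show "card ?B = card ?T" using inj by (rule card_image)
    show "V.independent ?B"
    proof (rule V.independent_if_scalars_zero)
      fix f b assume 0: "(\<Sum>b\<in>?B. cscale (f b) b) = 0" and "b \<in> ?B"
      then obtain C where C: "C \<in> ?T" "b = blade C" by blast
      have "(\<Sum>b\<in>?B. cscale (f b) b) C = 0" using 0 by simp
      then show "f b = 0" using C unfolding app by simp
    qed (use fin in simp)
    show "gsp n G \<subseteq> V.span ?B"
    proof
      fix U :: "nat set \<Rightarrow> 'k" assume U: "U \<in> gsp n G"
      define f where "f b = U (the_inv_into ?T blade b)" for b :: "nat set \<Rightarrow> 'k"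
      have f: "f (blade C) = U C" if "C \<in> ?T" for C
        unfolding f_def using the_inv_into_f_f[OF inj that] by simp
      have "U = (\<Sum>b\<in>?B. cscale (f b) b)"
      proof
        fix C
        show "U C = (\<Sum>b\<in>?B. cscale (f b) b) C"
          unfolding app using U f[of C] by (cases "C \<in> ?T") (auto simp: gsp_def Cl_def)
      qed
      also have "\<dots> \<in> V.span ?B" by (intro V.span_sum V.span_scale V.span_base)
      finally show "U \<in> V.span ?B" .
    qed
  qed
  then show ?thesis by (simp add: cdim_def subset_count_def)
qed

lemma subset_count_Un: "G \<inter> H = {} \<Longrightarrow> subset_count (G \<union> H) = subset_count G + subset_count H"
  unfolding subset_count_def by (subst card_Un_disjoint[symmetric]) (auto intro: arg_cong[of _ _ card])

lemma subset_count_0: "subset_count {0} = 1"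
proof -
  have "{A \<in> Pow I. card A \<in> {0}} = {{}}" by (auto simp: card_eq_0_iff')
  then show ?thesis by (simp add: subset_count_def)
qed

lemma subset_count_n: "subset_count {n} = 1"
proof -
  have "{A \<in> Pow I. card A \<in> {n}} = {A \<in> Pow I. A = I}" using card_eq_n_iff by blast
  also have "\<dots> = {I}" by blast
  finally have "{A \<in> Pow I. card A \<in> {n}} = {I}" .
  then show ?thesis by (simp add: subset_count_def)
qed

end

section \<open>Subsets counted by cardinality modulo 4\<close>

lemma card_subsets_Suc:
  "card {A \<in> Pow {0..<Suc n}. P (card A)} =
    card {A \<in> Pow {0..<n}. P (card A)} + card {A \<in> Pow {0..<n}. P (Suc (card A))}"
proof -
  \<comment> \<open>Pascal's rule, splitting by membership of the new element \<open>n\<close>.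
    Since \<open>n\<close> varies, the counting takes place outside the locale.\<close>
  have "{A \<in> Pow {0..<Suc n}. P (card A)} =
    {A \<in> Pow {0..<n}. P (card A)} \<union> insert n ` {A \<in> Pow {0..<n}. P (Suc (card A))}" (is "?L = ?R")
  proof (intro equalityI subsetI)
    fix A assume A: "A \<in> ?L"
    show "A \<in> ?R"
    proof (cases "n \<in> A")
      case True
      then have ins: "A = insert n (A - {n})" by auto
      have "finite A" using A finite_subset[of A "{0..<Suc n}"] by simp
      then have "card A = Suc (card (A - {n}))" using True by (rule card_Suc_Diff1[symmetric])
      moreover have "P (card A)" using A by simp
      ultimately have "P (Suc (card (A - {n})))" by simp
      moreover have "A - {n} \<subseteq> {0..<n}" using A by (auto simp: less_Suc_eq)
      ultimately have "A - {n} \<in> {A \<in> Pow {0..<n}. P (Suc (card A))}" by blast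
      then show ?thesis using ins by blast
    next
      case False
      then have "A \<subseteq> {0..<n}" using A by (auto simp: less_Suc_eq)
      then show ?thesis using A by blast
    qed
  next
    fix A assume "A \<in> ?R"
    then show "A \<in> ?L"
    proof
      assume "A \<in> insert n ` {A \<in> Pow {0..<n}. P (Suc (card A))}"
      then obtain B where B: "A = insert n B" "B \<subseteq> {0..<n}" "P (Suc (card B))" by auto
      then have "finite B" "n \<notin> B" using finite_subset[of B "{0..<n}"] by auto
      then show ?thesis using B by auto
    qed auto
  qed
  also have "card \<dots> = card {A \<in> Pow {0..<n}. P (card A)} + card (insert n ` {A \<in> Pow {0..<n}. P (Suc (card A))})"
    by (rule card_Un_disjoint) auto
  also have "card (insert n ` {A \<in> Pow {0..<n}. P (Suc (card A))}) = card {A \<in> Pow {0..<n}. P (Suc (card A))}"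
  proof (rule card_image, rule inj_onI)
    fix A B assume "A \<in> {A \<in> Pow {0..<n}. P (Suc (card A))}" "B \<in> {A \<in> Pow {0..<n}. P (Suc (card A))}" "insert n A = insert n B"
    moreover from this have "n \<notin> A" "n \<notin> B" by auto
    ultimately show "A = B" by (simp add: insert_ident)
  qed
  finally show ?thesis .
qed

text \<open>This is the real part of multiplication by 1+i, which has modulus \<open>sqrt 2\<close>
  and argument \<open>pi / 4\<close>; the sine version is the imaginary part.\<close>

lemma sqrt_2_mult_cos: "sqrt 2 * cos (t + pi / 4) = cos t - sin t"
proof -
  have *: "s * (a * (s / 2) - b * (s / 2)) = s * s / 2 * (a - b)" for a b s :: real
    by (simp add: field_simps)
  show ?thesis unfolding cos_add cos_45 sin_45 * by simp
qed

lemma sqrt_2_mult_sin: "sqrt 2 * sin (t + pi / 4) = cos t + sin t"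
proof -
  have *: "s * (b * (s / 2) + a * (s / 2)) = s * s / 2 * (a + b)" for a b s :: real
    by (simp add: field_simps)
  show ?thesis unfolding sin_add cos_45 sin_45 * by simp
qed

text \<open>The values are those of the fourth roots of unity filter: 2^n from (1+1)^n, and twice
  the real or imaginary part of (1+i)^n from the conjugate pair. The missing term (1-1)^n is 0 only
  for \<open>n \<ge> 1\<close>.\<close>

lemma card_subsets_mod_4:
  fixes n :: nat
  defines "N \<equiv> \<lambda>m. real (card {A \<in> Pow {0..<n}. card A mod 4 = m})"
  assumes "n \<ge> 1"
  shows "4 * N 0 = 2 ^ n + 2 * sqrt 2 ^ n * cos (pi * real n / 4)"
    and "4 * N 1 = 2 ^ n + 2 * sqrt 2 ^ n * sin (pi * real n / 4)"
    and "4 * N 2 = 2 ^ n - 2 * sqrt 2 ^ n * cos (pi * real n / 4)"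
    and "4 * N 3 = 2 ^ n - 2 * sqrt 2 ^ n * sin (pi * real n / 4)"
proof -
  define M where "M n m = real (card {A \<in> Pow {0..<n}. card A mod 4 = m})" for n m :: nat
  define x where "x n = sqrt 2 ^ n * cos (pi * real n / 4)" for n
  define y where "y n = sqrt 2 ^ n * sin (pi * real n / 4)" for n
  have arg: "pi * real (Suc n) / 4 = pi * real n / 4 + pi / 4" for n by (simp add: field_simps)
  have x: "x (Suc n) = x n - y n" for n
    unfolding x_def y_def arg power_Suc2 mult.assoc sqrt_2_mult_cos by (rule right_diff_distrib)
  have y: "y (Suc n) = x n + y n" for n
    unfolding x_def y_def arg power_Suc2 mult.assoc sqrt_2_mult_sin by (rule distrib_left)
  have rec: "M (Suc n) m = M n m + M n m'" if "\<And>k. Suc k mod 4 = m \<longleftrightarrow> k mod 4 = m'" for n m m'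
    using card_subsets_Suc[of n "\<lambda>k. k mod 4 = m"] unfolding M_def that by (simp only: of_nat_add)
  have rec': "M (Suc n) 0 = M n 0 + M n 3" "M (Suc n) 1 = M n 1 + M n 0"
    "M (Suc n) 2 = M n 2 + M n 1" "M (Suc n) 3 = M n 3 + M n 2" for n
    by (rule rec, presburger)+
  have M0: "M 0 m = (if m = 0 then 1 else 0)" for m
    by (auto simp: M_def card_eq_0_iff Collect_conv_if)
  have "4 * M n 0 = 2 ^ n + 2 * x n \<and> 4 * M n 1 = 2 ^ n + 2 * y n \<and>
      4 * M n 2 = 2 ^ n - 2 * x n \<and> 4 * M n 3 = 2 ^ n - 2 * y n"
    using assms(2)
  proof (induction n rule: dec_induct)
    case base
    \<comment> \<open>The formulas fail at 0, but the recursions hold there, so the case 1 is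
      obtained by one step from 0.\<close>
    have "x 0 = 1" "y 0 = 0" by (simp_all add: x_def y_def)
    then show ?case using rec'[of 0] x[of 0] y[of 0] by (simp add: M0)
  next
    case (step n)
    then show ?case unfolding rec' x y by simp
  qed
  then show "4 * N 0 = 2 ^ n + 2 * sqrt 2 ^ n * cos (pi * real n / 4)"
    and "4 * N 1 = 2 ^ n + 2 * sqrt 2 ^ n * sin (pi * real n / 4)"
    and "4 * N 2 = 2 ^ n - 2 * sqrt 2 ^ n * cos (pi * real n / 4)"
    and "4 * N 3 = 2 ^ n - 2 * sqrt 2 ^ n * sin (pi * real n / 4)"
    unfolding N_def M_def x_def y_def by (simp_all add: mult.assoc)
qed

lemma two_powr_half: "2 powr (real n / 2) = sqrt 2 ^ n"
proof -
  have "2 powr (real n / 2) = (2 powr (1 / 2)) powr real n" by (simp add: powr_powr)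
  then show ?thesis by (simp add: powr_half_sqrt powr_realpow)
qed

section \<open>Dimensions and comparison of the Lie algebras\<close>

context clifford
begin

text \<open>Each count consists of full residue classes, one more for grade 0 unless it lies in a
  class, and one more for grade \<open>n\<close> when it is central and outside the classes.\<close>

lemma dimension_formulas:
  assumes n: "n \<ge> 2"
  shows "real (subset_count (Zg \<union> {k. even k})) = 2 ^ (n - 1) + ind (odd n)" (is ?p)
    and "real (subset_count (Zg \<union> {k. k mod 4 = 2 \<or> k mod 4 = 3})) =
      2 ^ (n - 1) - 2 powr ((real n - 1) / 2) * sin (pi * (real n + 1) / 4) + 1 + ind (n mod 4 = 1)" (is ?a)
    and "real (subset_count (Zg \<union> {k. k mod 4 = 1 \<or> k mod 4 = 2})) =
      2 ^ (n - 1) - 2 powr ((real n - 1) / 2) * cos (pi * (real n + 1) / 4) + 1 + ind (n mod 4 = 3)" (is ?b)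
    and "real (subset_count (Zg \<union> {k. k mod 4 = 2})) =
      2 ^ (n - 2) - 2 powr ((real n - 2) / 2) * cos (pi * real n / 4) + 1 + ind (odd n)" (is ?q)
proof -
  define N where "N m = subset_count {k. k mod 4 = m}" for m
  define x where "x = sqrt 2 ^ n * cos (pi * real n / 4)"
  define y where "y = sqrt 2 ^ n * sin (pi * real n / 4)"
  have N: "4 * real (N 0) = 2 ^ n + 2 * x" "4 * real (N 1) = 2 ^ n + 2 * y"
    "4 * real (N 2) = 2 ^ n - 2 * x" "4 * real (N 3) = 2 ^ n - 2 * y"
    using card_subsets_mod_4[of n, unfolded mult.assoc, folded x_def y_def] n
    by (simp_all only: N_def subset_count_def mem_Collect_eq)
  have pow: "(2::real) ^ n = 2 * 2 ^ (n - 1)" "(2::real) ^ n = 4 * 2 ^ (n - 2)"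
  proof -
    from n obtain m where "n = 2 + m" using le_Suc_ex by blast
    then show "(2::real) ^ n = 2 * 2 ^ (n - 1)" "(2::real) ^ n = 4 * 2 ^ (n - 2)" by simp_all
  qed
  have arg: "pi * (real n + 1) / 4 = pi * real n / 4 + pi / 4" by (simp add: field_simps)
  \<comment> \<open>Writing (n-1)/2 as (n+1)/2 - 1 supplies the extra \<open>sqrt 2\<close> consumed
    by the angle addition formulas.\<close>
  have "(real n - 1) / 2 = real (Suc n) / 2 - 1" "(real n - 2) / 2 = real n / 2 - 1"
    by (simp_all add: field_simps)
  then have half: "2 powr ((real n - 1) / 2) = sqrt 2 ^ Suc n / 2" "2 powr ((real n - 2) / 2) = sqrt 2 ^ n / 2"
    unfolding powr_diff by (simp_all only: two_powr_half powr_diff) simp_all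
  have trig: "2 powr ((real n - 1) / 2) * sin (pi * (real n + 1) / 4) = (x + y) / 2"
    "2 powr ((real n - 1) / 2) * cos (pi * (real n + 1) / 4) = (x - y) / 2"
    "2 powr ((real n - 2) / 2) * cos (pi * real n / 4) = x / 2"
    unfolding half arg x_def y_def times_divide_eq_left power_Suc2 mult.assoc sqrt_2_mult_cos sqrt_2_mult_sin
    by (simp_all only: right_diff_distrib distrib_left)
  have sc: "subset_count ({0} \<union> G) = 1 + subset_count G" if "0 \<notin> G" for G
    using subset_count_Un[of "{0}" G] that by (simp add: subset_count_0)
  have scn: "subset_count (G \<union> {n}) = subset_count G + 1" if "n \<notin> G" for G
    using subset_count_Un[of G "{n}"] that by (simp add: subset_count_n)
  have sc0n: "subset_count ({0} \<union> G \<union> {n}) = 1 + subset_count G + 1" if "0 \<notin> G" "n \<notin> G" for G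
    using n that sc[of G] by (subst scn) auto
  have N2: "subset_count {k. k mod 4 = i \<or> k mod 4 = j} = N i + N j" if "i \<noteq> j" for i j
    unfolding N_def using that by (subst subset_count_Un[symmetric]) (auto intro: arg_cong[of _ _ subset_count])
  have "{k::nat. even k} = {k. k mod 4 = 0 \<or> k mod 4 = 2}" by (auto; presburger)
  with N2[of 0 2] have ev: "subset_count {k. even k} = N 0 + N 2" by simp
  show ?p
  proof (cases "odd n")
    case True
    then have "Zg \<union> {k. even k} = {k. even k} \<union> {n}" by (auto simp: Zg_def)
    then have "subset_count (Zg \<union> {k. even k}) = N 0 + N 2 + 1" using True scn[of "{k. even k}"] ev by simp
    then show ?thesis using True N pow by (simp add: ind_def)
  next
    case False
    then have "Zg \<union> {k. even k} = {k. even k}" by (auto simp: Zg_def)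
    then have "subset_count (Zg \<union> {k. even k}) = N 0 + N 2" using ev by simp
    then show ?thesis using False N pow by (simp add: ind_def)
  qed
  show ?a
  proof (cases "n mod 4 = 1")
    case True
    then have "odd n" by presburger
    then have "Zg \<union> {k. k mod 4 = 2 \<or> k mod 4 = 3} = {0} \<union> {k. k mod 4 = 2 \<or> k mod 4 = 3} \<union> {n}"
      by (auto simp: Zg_def)
    then have "subset_count (Zg \<union> {k. k mod 4 = 2 \<or> k mod 4 = 3}) = 1 + (N 2 + N 3) + 1"
      using True N2[of 2 3] by (simp only:) (subst sc0n, simp_all)
    then show ?thesis using True N pow unfolding trig by (simp add: ind_def field_simps)
  next
    case False
    \<comment> \<open>Grade \<open>n\<close>, if central, already belongs to the residue class 3 and
      must not be counted again.\<close>
    then have "odd n \<Longrightarrow> n mod 4 = 3" by presburger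
    then have "Zg \<union> {k. k mod 4 = 2 \<or> k mod 4 = 3} = {0} \<union> {k. k mod 4 = 2 \<or> k mod 4 = 3}"
      by (auto simp: Zg_def)
    then have "subset_count (Zg \<union> {k. k mod 4 = 2 \<or> k mod 4 = 3}) = 1 + (N 2 + N 3)"
      using N2[of 2 3] by (simp only:) (subst sc, simp_all)
    then show ?thesis using False N pow unfolding trig by (simp add: ind_def field_simps)
  qed
  show ?b
  proof (cases "n mod 4 = 3")
    case True
    then have "odd n" by presburger
    then have "Zg \<union> {k. k mod 4 = 1 \<or> k mod 4 = 2} = {0} \<union> {k. k mod 4 = 1 \<or> k mod 4 = 2} \<union> {n}"
      by (auto simp: Zg_def)
    then have "subset_count (Zg \<union> {k. k mod 4 = 1 \<or> k mod 4 = 2}) = 1 + (N 1 + N 2) + 1"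
      using True N2[of 1 2] by (simp only:) (subst sc0n, simp_all)
    then show ?thesis using True N pow unfolding trig by (simp add: ind_def field_simps)
  next
    case False
    then have "odd n \<Longrightarrow> n mod 4 = 1" by presburger
    then have "Zg \<union> {k. k mod 4 = 1 \<or> k mod 4 = 2} = {0} \<union> {k. k mod 4 = 1 \<or> k mod 4 = 2}"
      by (auto simp: Zg_def)
    then have "subset_count (Zg \<union> {k. k mod 4 = 1 \<or> k mod 4 = 2}) = 1 + (N 1 + N 2)"
      using N2[of 1 2] by (simp only:) (subst sc, simp_all)
    then show ?thesis using False N pow unfolding trig by (simp add: ind_def field_simps)
  qed
  show ?q
  proof (cases "odd n")
    case True
    then have mod: "n mod 4 \<noteq> 2" by presburger
    have "Zg \<union> {k. k mod 4 = 2} = {0} \<union> {k. k mod 4 = 2} \<union> {n}"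
      using True by (auto simp: Zg_def)
    then have "subset_count (Zg \<union> {k. k mod 4 = 2}) = 1 + N 2 + 1"
      using True mod N_def[of 2] by (simp only:) (subst sc0n, simp_all)
    then show ?thesis using True N pow unfolding trig by (simp add: ind_def field_simps)
  next
    case False
    then have "Zg \<union> {k. k mod 4 = 2} = {0} \<union> {k. k mod 4 = 2}"
      by (auto simp: Zg_def)
    then have "subset_count (Zg \<union> {k. k mod 4 = 2}) = 1 + N 2"
      using N_def[of 2] by (simp only:) (subst sc, simp_all)
    then show ?thesis using False N pow unfolding trig by (simp add: ind_def field_simps)
  qed
qed

lemma gsp_neqI:
  "k \<le> n \<Longrightarrow> (k \<in> G) \<noteq> (k \<in> H) \<Longrightarrow> (gsp n G :: (nat set \<Rightarrow> 'k) set) \<noteq> gsp n H"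
  unfolding gsp_eq_iff by blast

lemma lie_algebras_claims:
  assumes n: "n \<ge> 2"
  shows "lie_algebras_claims n eta"
proof -
  have Q: "lie n eta (Qgrp n eta) = gsp n (Zg \<union> {k. k mod 4 = 2})"
    unfolding lie_Qgrp lie_Agrp lie_Pgrp gsp_Int gsp_eq_iff Zg_def
    by (auto; presburger)
  \<comment> \<open>Grade \<open>n\<close> is present for every \<open>n\<close>: it is central if
    \<open>n\<close> is odd and in the residue class if \<open>n\<close> is 2 modulo 4. Only for
    multiples of 4 is it new.\<close>
  have Q': "lie n eta (Q'grp n eta) = gsp n (insert n (Zg \<union> {k. k mod 4 = 2}))"
    unfolding lie_Q'grp gsp_eq_iff Zg_def by (auto; presburger)
  have four: "cdim (gsp n (insert n (Zg \<union> {k. k mod 4 = 2})) :: (nat set \<Rightarrow> 'k) set) =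
      cdim (gsp n (Zg \<union> {k. k mod 4 = 2}) :: (nat set \<Rightarrow> 'k) set) + 1" if "n mod 4 = 0"
  proof -
    have "n \<notin> Zg \<union> {k. k mod 4 = 2}" using that n by (auto simp: Zg_def)
    then show ?thesis
      using subset_count_Un[of "Zg \<union> {k. k mod 4 = 2}" "{n}"] unfolding cdim_gsp by (simp add: subset_count_n)
  qed
  \<comment> \<open>Each inequality follows from one separating grade. For \<open>n = 4\<close>,
    grade 4 lies only in the algebra of P, and grade 3 only in that of A.\<close>
  have neq1: "n = 4 \<Longrightarrow> (gsp n (Zg \<union> {k. k mod 4 = 2}) :: (nat set \<Rightarrow> 'k) set) \<noteq> gsp n (Zg \<union> {k. even k})"
    unfolding Zg_def by (rule gsp_neqI[of 4]) (use n in simp_all)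
  have neq2: "n = 4 \<Longrightarrow> (gsp n (Zg \<union> {k. even k}) :: (nat set \<Rightarrow> 'k) set)
        \<noteq> gsp n (Zg \<union> {k. k mod 4 = 2 \<or> k mod 4 = 3})"
    unfolding Zg_def by (rule gsp_neqI[of 4]) (use n in simp_all)
  have neq3: "n = 4 \<Longrightarrow> (gsp n (Zg \<union> {k. k mod 4 = 2}) :: (nat set \<Rightarrow> 'k) set)
        \<noteq> gsp n (Zg \<union> {k. k mod 4 = 2 \<or> k mod 4 = 3})"
    unfolding Zg_def by (rule gsp_neqI[of 3]) (use n in simp_all)
  have neq4: "n = 6 \<Longrightarrow> (gsp n (insert 2 Zg) :: (nat set \<Rightarrow> 'k) set) \<noteq> gsp n (Zg \<union> {k. k mod 4 = 2})"
    unfolding Zg_def by (rule gsp_neqI[of 6]) (use n in simp_all)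
  have neq5: "n mod 4 = 0 \<Longrightarrow> (gsp n (Zg \<union> {k. k mod 4 = 2}) :: (nat set \<Rightarrow> 'k) set)
        \<noteq> gsp n (insert n (Zg \<union> {k. k mod 4 = 2}))"
    unfolding Zg_def by (rule gsp_neqI[of n]) (use n in \<open>simp_all, presburger\<close>)
  \<comment> \<open>Grade 4 is even, not 2 modulo 4, and differs from \<open>n\<close> once
    \<open>n \<ge> 8\<close>.\<close>
  have neq6: "n \<ge> 8 \<Longrightarrow> (gsp n (insert n (Zg \<union> {k. k mod 4 = 2})) :: (nat set \<Rightarrow> 'k) set) \<noteq> gsp n (Zg \<union> {k. even k})"
    unfolding Zg_def by (rule gsp_neqI[of 4]) (use n in simp_all)
  note dims = dimension_formulas[OF n, folded cdim_gsp]
  \<comment> \<open>Apart from dimensions and inequalities, every remaining claim now concerns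
    membership of single grades \<open>k \<le> n\<close> and is decided by Presburger
    arithmetic.\<close>
  show ?thesis
    unfolding lie_algebras_claims_def Let_def Q Q' lie_Pgrp lie_Agrp lie_Bgrp lie_Gammagrp
      Cgr_def Ceven_def Cbar_def dsum_gsp gsp_Int
    by (intro conjI impI; (rule dims | erule four neq1 neq2 neq3 neq4 neq5 neq6 |
      (unfold Zg_def gsp_eq_iff gsp_subset_iff, simp only: gsp_eq_iff Un_iff Int_iff insert_iff mem_Collect_eq empty_iff
          split: if_split, (intro conjI impI allI)?; use n in presburger)))
qed

end

theorem mainTheorem18:
  fixes n :: nat
  assumes "n \<ge> 2"
  shows "(\<forall>p q. p + q = n \<longrightarrow> lie_algebras_claims n (eta_pq p))
       \<and> lie_algebras_claims n (\<lambda>_. 1 :: complex)"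
proof (intro conjI allI impI)
  fix p q
  interpret clifford n "eta_pq p" by standard (simp add: eta_pq_def)
  show "lie_algebras_claims n (eta_pq p)" by (rule lie_algebras_claims[OF assms])
next
  interpret clifford n "\<lambda>_. 1 :: complex" by standard simp
  show "lie_algebras_claims n (\<lambda>_. 1 :: complex)" by (rule lie_algebras_claims[OF assms])
qed

end
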